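(* For each $N\in\mathbb{N}$ let $A_N$ be distributed according to the Haar probability measure on the orthogonal group $\mathcal{O}(N)$, and assume that the matrices $A_N$, $N\in\mathbb{N}$, are defined on a common probability space. Let $(m_N)_N$, $(k_N)_N$ be sequences of natural numbers such that $p_N:=m_Nk_N=\lfloor N^\alpha\rfloor$ for some $\alpha\in(0,1)$. Let $X_N$ be the $m_N\times k_N$ upper left block of $A_N$, let $y_{i,j}^{(N)}=\sqrt N\,(X_N)_{i,j}$, and define the random empirical measure $$\nu_N:=\frac1{p_N}\sum_{i=1}^{m_N}\sum_{j=1}^{k_N}\delta_{y_{i,j}^{(N)}}.$$ Then, with probability $1$, the sequence $\nu_N$ converges to the standard Gaussian measure $\gamma$ on $\mathbb{R}$ as $N\to\infty$ in the weak topology.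
   Context: $\mathcal{O}(N)$ is the group of real $N\times N$ matrices $A$ with $AA^\top=A^\top A=\operatorname{Id}_N$. $\delta_x$ is the Dirac measure at $x$. The weak topology on the space of probability measures on $\mathbb{R}$ is the coarsest topology making $\mu\mapsto\int f\,d\mu$ continuous for every bounded continuous $f:\mathbb{R}\to\mathbb{R}$. No assumption is made on the joint distribution of the $A_N$ for different $N$. *)

theory Defs
  imports "HOL-Probability.Probability" "Jordan_Normal_Form.Matrix"
begin

definition orthogonal_group :: "nat \<Rightarrow> real mat set" where
  "orthogonal_group N =
     {A \<in> carrier_mat N N. A * transpose_mat A = 1\<^sub>m N \<and> transpose_mat A * A = 1\<^sub>m N}"

text \<open>
  The Borel \<open>\<sigma>\<close>-algebra of the orthogonal group as a subspace of the \<open>N * N\<close>-dimensional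
  Euclidean space of matrix entries. The type of matrices carries no topology, so the
  \<open>\<sigma>\<close>-algebra is pulled back along the entries; on the finite product of real lines the
  product \<open>\<sigma>\<close>-algebra is the Borel \<open>\<sigma>\<close>-algebra.
\<close>
definition orthogonal_borel :: "nat \<Rightarrow> real mat measure" where
  "orthogonal_borel N =
     vimage_algebra (orthogonal_group N)
       (\<lambda>A. \<lambda>ij \<in> {..<N} \<times> {..<N}. A $$ ij)
       (PiM ({..<N} \<times> {..<N}) (\<lambda>_. borel))"

text \<open>
  Only left invariance is demanded: the group is compact, so there is exactly one such
  measure, and it is right invariant as well.
\<close>
definition haar_probability :: "nat \<Rightarrow> real mat measure \<Rightarrow> bool" where
  "haar_probability N \<mu> \<longleftrightarrow>
     prob_space \<mu> \<and>
     space \<mu> = orthogonal_group N \<and>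
     sets \<mu> = sets (orthogonal_borel N) \<and>
     (\<forall>U \<in> orthogonal_group N. distr \<mu> (orthogonal_borel N) (\<lambda>A. U * A) = \<mu>)"

definition upper_left_block :: "nat \<Rightarrow> nat \<Rightarrow> 'a mat \<Rightarrow> 'a mat" where
  "upper_left_block m k A = mat m k (\<lambda>(i, j). A $$ (i, j))"

text \<open>
  The average of the Dirac measures at the entries of a matrix. An empty matrix gives the zero measure, since \<open>1 / 0 = 0\<close>.
\<close>
definition empirical_measure :: "real mat \<Rightarrow> real measure" where
  "empirical_measure Y =
     measure_of UNIV (sets borel)
       (\<lambda>B. ennreal (1 / real (dim_row Y * dim_col Y)) *
         (\<Sum>i<dim_row Y. \<Sum>j<dim_col Y. emeasure (return borel (Y $$ (i, j))) B))"

definition borel_probabilities :: "real measure set" where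
  "borel_probabilities = {\<mu>. prob_space \<mu> \<and> sets \<mu> = sets borel}"

text \<open>
  The coarsest topology on the Borel probability measures that makes
  \<open>\<mu> \<mapsto> \<integral>f d\<mu>\<close> continuous for all bounded continuous \<open>f\<close>:
  the preimages of open sets under these maps form a subbasis.
\<close>
definition weak_topology :: "real measure topology" where
  "weak_topology = topology_generated_by
     {{\<mu> \<in> borel_probabilities. (\<integral>x. f x \<partial>\<mu>) \<in> V} | (f :: real \<Rightarrow> real) (V :: real set).
        continuous_on UNIV f \<and> bounded (range f) \<and> open V}"

end

theory Submission imports Defs begin

text \<open>
  The proof compares the empirical measure with the Gaussian through Stein's characterisation:
  \<open>\<gamma>\<close> is the only probability measure with all moments for which
  \<open>\<integral> (x * u x - u' x) d\<gamma> = 0\<close> holds for every polynomial \<open>u\<close>. With \<open>u = x ^ s\<close> this is the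
  recurrence \<open>E x ^ (s + 1) = s * E x ^ (s - 1)\<close>, and it fixes all moments. So it suffices that,
  for each polynomial \<open>u\<close>, the average \<open>G\<close> of \<open>y * u y - u' y\<close> over the \<open>p\<close> rescaled entries \<open>y\<close> of
  the block tends to \<open>0\<close> almost surely.

  Nothing is known about the joint law for different \<open>N\<close>, so almost sure convergence has to come
  from summable moments of \<open>G\<close>; since \<open>p\<close> is only about \<open>N powr \<alpha>\<close> with \<open>\<alpha>\<close> possibly tiny,
  arbitrarily high moments are needed. The key estimate \<open>block_average_moment\<close> is
  \<open>E G ^ (2 * q) \<le> C / p ^ q\<close> with \<open>C\<close> depending only on \<open>u\<close> and \<open>q\<close>; choosing \<open>q * \<alpha> \<ge> 2\<close> makes
  the moments summable.

  The key estimate rests on an exact integration by parts formula for the Haar measure,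
  \<open>stein_identity\<close>. Invariance under the rotation of two rows by the angle \<open>\<theta>\<close>, differentiated at
  \<open>\<theta> = 0\<close>, gives a vanishing expectation; summing over the second row and using that the columns
  are orthonormal yields, for \<open>y = sqrt N * A\<close>,
  \<open>(1 - 1 / N) * E (y i j * \<phi>) = E (\<partial> i j \<phi>) - 1 / N * E (\<Sum>b l. y i l * y b j * \<partial> b l \<phi>)\<close>.
  This is Gaussian integration by parts up to terms of relative size \<open>1 / N\<close>. Inserting a power of
  an entry bounds the moments of the entries by the Gaussian ones. Inserting
  \<open>\<phi> = u (y e) * G ^ (2 * q - 1)\<close> and averaging over the positions \<open>e\<close> of the block yields
  \<open>E G ^ (2 * q) = E (R * G ^ (2 * q - 1)) + E (W * G ^ (2 * q - 2))\<close>, where \<open>R\<close> and \<open>W\<close> are \<open>1 / p\<close>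
  times quantities with bounded moments: the derivative of \<open>G\<close> in one entry has a factor
  \<open>1 / p\<close>, and \<open>1 / N \<le> 1 / p\<close>. Young's inequality absorbs the powers of \<open>G\<close> into the left-hand side.

  Finally, convergence of all moments implies convergence of the characteristic functions by Taylor
  expansion, Levy's theorem (\<open>levy_continuity\<close>) turns this into weak convergence, and the
  generators of the weak topology are sets determined by the integral of one bounded continuous
  function.
\<close>

section \<open>Rotations of two rows\<close>

definition plane_rotation :: "nat \<Rightarrow> nat \<Rightarrow> nat \<Rightarrow> real \<Rightarrow> real mat" where
  "plane_rotation N a b \<theta> = mat N N (\<lambda>(i, j).
     if i = a then (if j = a then cos \<theta> else if j = b then sin \<theta> else 0)
     else if i = b then (if j = b then cos \<theta> else if j = a then - sin \<theta> else 0)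
     else if i = j then 1 else 0)"

lemma plane_rotation_carrier [simp]: "plane_rotation N a b \<theta> \<in> carrier_mat N N"
  by (simp add: plane_rotation_def)

lemma index_mult_mat_sum:
  fixes U B :: "real mat"
  assumes "U \<in> carrier_mat N N" "B \<in> carrier_mat N N" "i < N" "j < N"
  shows "(U * B) $$ (i, j) = (\<Sum>l<N. U $$ (i, l) * B $$ (l, j))"
  using assms by (simp add: scalar_prod_def lessThan_atLeast0)

lemma plane_rotation_mult_index:
  assumes "B \<in> carrier_mat N N" "a < N" "b < N" "a \<noteq> b" "i < N" "j < N"
  shows "(plane_rotation N a b \<theta> * B) $$ (i, j) =
    (if i = a then cos \<theta> * B $$ (a, j) + sin \<theta> * B $$ (b, j)
     else if i = b then cos \<theta> * B $$ (b, j) - sin \<theta> * B $$ (a, j)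
     else B $$ (i, j))"
proof -
  let ?R = "plane_rotation N a b \<theta>"
  have row: "?R $$ (i, l) * B $$ (l, j) =
     (if l = a then (if i = a then cos \<theta> else if i = b then - sin \<theta> else 0) * B $$ (a, j) else 0)
     + (if l = b then (if i = a then sin \<theta> else if i = b then cos \<theta> else 0) * B $$ (b, j) else 0)
     + (if l = i then (if i = a \<or> i = b then 0 else B $$ (i, j)) else 0)" if "l < N" for l
    using assms that by (auto simp: plane_rotation_def)
  have "(?R * B) $$ (i, j) = (\<Sum>l<N. ?R $$ (i, l) * B $$ (l, j))"
    using assms by (intro index_mult_mat_sum) auto
  also have "\<dots> = (\<Sum>l<N. (if l = a then (if i = a then cos \<theta> else if i = b then - sin \<theta> else 0) * B $$ (a, j) else 0)
     + (if l = b then (if i = a then sin \<theta> else if i = b then cos \<theta> else 0) * B $$ (b, j) else 0)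
     + (if l = i then (if i = a \<or> i = b then 0 else B $$ (i, j)) else 0))"
    by (intro sum.cong refl row) auto
  also have "\<dots> = (if i = a then cos \<theta> else if i = b then - sin \<theta> else 0) * B $$ (a, j)
     + (if i = a then sin \<theta> else if i = b then cos \<theta> else 0) * B $$ (b, j)
     + (if i = a \<or> i = b then 0 else B $$ (i, j))"
    using assms by (simp only: sum.distrib sum.delta finite_lessThan lessThan_iff if_True)
  finally show ?thesis using assms by auto
qed

text \<open>
  Reading the second factor as the matrix that is acted upon turns this into the addition of angles in
  one plane, so that no product of two rotations has to be expanded.
\<close>
lemma plane_rotation_inverse:
  assumes "a < N" "b < N" "a \<noteq> b"
  shows "plane_rotation N a b \<theta> * plane_rotation N a b (- \<theta>) = 1\<^sub>m N"
proof (rule eq_matI)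
  fix i j assume "i < dim_row (1\<^sub>m N :: real mat)" "j < dim_col (1\<^sub>m N :: real mat)"
  hence ij: "i < N" "j < N" by auto
  have sc: "cos \<theta> * cos \<theta> + sin \<theta> * sin \<theta> = 1"
    using sin_cos_squared_add2[of \<theta>] by (simp add: power2_eq_square add.commute)
  show "(plane_rotation N a b \<theta> * plane_rotation N a b (- \<theta>)) $$ (i, j) = 1\<^sub>m N $$ (i, j)"
    using assms ij sc
    by (simp add: plane_rotation_mult_index) (auto simp: plane_rotation_def algebra_simps)
qed (auto simp: plane_rotation_def)

lemma plane_rotation_orthogonal:
  assumes "a < N" "b < N" "a \<noteq> b"
  shows "plane_rotation N a b \<theta> \<in> orthogonal_group N"
proof -
  have "transpose_mat (plane_rotation N a b \<theta>) = plane_rotation N a b (- \<theta>)"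
    using assms by (intro eq_matI) (auto simp: plane_rotation_def)
  thus ?thesis
    using plane_rotation_inverse[OF assms, of \<theta>] plane_rotation_inverse[OF assms, of "- \<theta>"]
    by (simp add: orthogonal_group_def)
qed

section \<open>The orthogonal group and its Borel sets\<close>

lemma orthogonal_group_mult:
  assumes "U \<in> orthogonal_group N" "A \<in> orthogonal_group N"
  shows "U * A \<in> orthogonal_group N"
proof -
  from assms have c: "U \<in> carrier_mat N N" "A \<in> carrier_mat N N"
    "transpose_mat U \<in> carrier_mat N N" "transpose_mat A \<in> carrier_mat N N"
    and o: "U * transpose_mat U = 1\<^sub>m N" "transpose_mat U * U = 1\<^sub>m N"
    "A * transpose_mat A = 1\<^sub>m N" "transpose_mat A * A = 1\<^sub>m N"
    by (auto simp: orthogonal_group_def)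
  have t: "transpose_mat (U * A) = transpose_mat A * transpose_mat U"
    using c by (intro transpose_mult)
  have "U * A * (transpose_mat A * transpose_mat U) = U * (A * transpose_mat A) * transpose_mat U"
    using c by (simp add: assoc_mult_mat[of _ N N _ N _ N])
  moreover have "transpose_mat A * transpose_mat U * (U * A) = transpose_mat A * (transpose_mat U * U) * A"
    using c by (simp add: assoc_mult_mat[of _ N N _ N _ N])
  ultimately show ?thesis
    unfolding orthogonal_group_def using c o t by simp
qed

lemma orthogonal_columns:
  assumes "A \<in> orthogonal_group N" "j < N" "l < N"
  shows "(\<Sum>b<N. A $$ (b, j) * A $$ (b, l)) = (if j = l then 1 else 0)"
proof -
  from assms have c: "A \<in> carrier_mat N N" and o: "transpose_mat A * A = 1\<^sub>m N"
    by (auto simp: orthogonal_group_def)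
  have "(if j = l then 1 else 0) = (transpose_mat A * A) $$ (j, l)"
    using assms by (simp add: o)
  also have "\<dots> = (\<Sum>b<N. A $$ (b, j) * A $$ (b, l))"
    using c assms by (subst index_mult_mat_sum[of _ N]) (auto intro!: sum.cong)
  finally show ?thesis by simp
qed

lemma orthogonal_entry_bound:
  assumes "A \<in> orthogonal_group N" "i < N" "j < N"
  shows "\<bar>A $$ (i, j)\<bar> \<le> 1"
proof -
  have "A $$ (i, j) * A $$ (i, j) \<le> (\<Sum>b<N. A $$ (b, j) * A $$ (b, j))"
    using assms by (intro member_le_sum) auto
  also have "\<dots> = 1" using orthogonal_columns[OF assms(1,3,3)] by simp
  finally show ?thesis by (simp add: abs_square_le_1 power2_eq_square flip: abs_square_le_1)
qed

lemma entry_measurable: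
  assumes "i < N" "j < N"
  shows "(\<lambda>A. A $$ (i, j)) \<in> borel_measurable (orthogonal_borel N)"
proof -
  have "(\<lambda>A. \<lambda>ij \<in> {..<N} \<times> {..<N}. A $$ ij) \<in> orthogonal_borel N \<rightarrow>\<^sub>M PiM ({..<N} \<times> {..<N}) (\<lambda>_. borel :: real measure)"
    unfolding orthogonal_borel_def by (rule measurable_vimage_algebra1) (auto simp: space_PiM)
  from measurable_compose[OF this measurable_component_singleton[of "(i, j)"]] assms
  show ?thesis by simp
qed

lemma space_orthogonal_borel [simp]: "space (orthogonal_borel N) = orthogonal_group N"
  by (simp add: orthogonal_borel_def)

text \<open>
  The Borel sets are generated by the entries, and the entries of \<open>U * A\<close> are linear in those of \<open>A\<close>.
\<close>
lemma left_mult_measurable: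
  assumes U: "U \<in> orthogonal_group N"
  shows "(\<lambda>A. U * A) \<in> orthogonal_borel N \<rightarrow>\<^sub>M orthogonal_borel N"
proof -
  have "(\<lambda>A. \<lambda>ij \<in> {..<N} \<times> {..<N}. (U * A) $$ ij) \<in> orthogonal_borel N \<rightarrow>\<^sub>M PiM ({..<N} \<times> {..<N}) (\<lambda>_. borel :: real measure)"
  proof (rule measurable_restrict)
    fix ij assume "ij \<in> {..<N} \<times> {..<N}"
    then obtain i j where ij: "ij = (i, j)" "i < N" "j < N" by auto
    have "(\<lambda>A. \<Sum>l<N. U $$ (i, l) * A $$ (l, j)) \<in> borel_measurable (orthogonal_borel N)"
      using ij by (intro borel_measurable_sum borel_measurable_times entry_measurable) auto
    moreover have "(U * A) $$ ij = (\<Sum>l<N. U $$ (i, l) * A $$ (l, j))" if "A \<in> orthogonal_group N" for A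
      using that U ij index_mult_mat_sum[of U N A i j] by (auto simp: orthogonal_group_def)
    ultimately show "(\<lambda>A. (U * A) $$ ij) \<in> borel_measurable (orthogonal_borel N)"
      by (subst measurable_cong) auto
  qed
  hence "(\<lambda>A. U * A) \<in> orthogonal_borel N \<rightarrow>\<^sub>M vimage_algebra (orthogonal_group N)
       (\<lambda>A. \<lambda>ij \<in> {..<N} \<times> {..<N}. A $$ ij) (PiM ({..<N} \<times> {..<N}) (\<lambda>_. borel))"
    using U by (intro measurable_vimage_algebra2) (auto intro: orthogonal_group_mult)
  thus ?thesis by (simp add: orthogonal_borel_def)
qed

section \<open>Bounded observables\<close>

text \<open>
  Boundedness replaces the compactness argument for continuous functions: every function that occurs
  below is a polynomial in the entries, and those lie in \<open>[-1, 1]\<close>. It makes all integrability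
  conditions trivial and provides the dominating function for differentiation under the integral.
\<close>
definition bounded_observable :: "nat \<Rightarrow> (real mat \<Rightarrow> real) \<Rightarrow> bool" where
  "bounded_observable N f \<longleftrightarrow>
     f \<in> borel_measurable (orthogonal_borel N) \<and> (\<exists>B. \<forall>A \<in> orthogonal_group N. \<bar>f A\<bar> \<le> B)"

lemma bounded_observable_const [intro]: "bounded_observable N (\<lambda>_. c)"
  by (auto simp: bounded_observable_def)

lemma bounded_observable_add [intro]:
  assumes "bounded_observable N f" "bounded_observable N g"
  shows "bounded_observable N (\<lambda>A. f A + g A)"
proof -
  from assms obtain B C where "\<forall>A \<in> orthogonal_group N. \<bar>f A\<bar> \<le> B" "\<forall>A \<in> orthogonal_group N. \<bar>g A\<bar> \<le> C"
    by (auto simp: bounded_observable_def)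
  hence "\<forall>A \<in> orthogonal_group N. \<bar>f A + g A\<bar> \<le> B + C"
    by (auto intro: order_trans[OF abs_triangle_ineq] add_mono)
  thus ?thesis using assms by (auto simp: bounded_observable_def)
qed

lemma bounded_observable_mult [intro]:
  assumes "bounded_observable N f" "bounded_observable N g"
  shows "bounded_observable N (\<lambda>A. f A * g A)"
proof -
  from assms obtain B C where BC: "\<forall>A \<in> orthogonal_group N. \<bar>f A\<bar> \<le> B" "\<forall>A \<in> orthogonal_group N. \<bar>g A\<bar> \<le> C"
    by (auto simp: bounded_observable_def)
  have "\<bar>f A * g A\<bar> \<le> \<bar>B\<bar> * \<bar>C\<bar>" if "A \<in> orthogonal_group N" for A
    unfolding abs_mult using BC that by (intro mult_mono) force+
  thus ?thesis using assms by (auto simp: bounded_observable_def)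
qed

lemma bounded_observable_uminus [intro]:
  "bounded_observable N f \<Longrightarrow> bounded_observable N (\<lambda>A. - f A)"
  by (auto simp: bounded_observable_def)

lemma bounded_observable_diff [intro]:
  assumes "bounded_observable N f" "bounded_observable N g"
  shows "bounded_observable N (\<lambda>A. f A - g A)"
  using bounded_observable_add[OF assms(1) bounded_observable_uminus[OF assms(2)]] by simp

lemma bounded_observable_divide [intro]:
  assumes "bounded_observable N f" shows "bounded_observable N (\<lambda>A. f A / c)"
  using bounded_observable_mult[OF assms bounded_observable_const[of N "1 / c"]] by simp

lemma bounded_observable_power [intro]:
  "bounded_observable N f \<Longrightarrow> bounded_observable N (\<lambda>A. f A ^ n)"
  by (induction n) (auto simp: bounded_observable_const)

lemma bounded_observable_sum [intro]:
  assumes "\<And>x. x \<in> S \<Longrightarrow> bounded_observable N (f x)"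
  shows "bounded_observable N (\<lambda>A. \<Sum>x\<in>S. f x A)"
  using assms by (induction S rule: infinite_finite_induct) auto

lemma bounded_observable_poly [intro]:
  fixes p :: "real poly"
  assumes "bounded_observable N f"
  shows "bounded_observable N (\<lambda>A. poly p (f A))"
  using assms by (induction p) auto

text \<open>
  The normalisation by \<open>sqrt N\<close> gives every entry second moment \<open>1\<close>.
\<close>
definition scaled_entry :: "nat \<Rightarrow> nat \<Rightarrow> nat \<Rightarrow> real mat \<Rightarrow> real" where
  "scaled_entry N i j A = sqrt (real N) * A $$ (i, j)"

lemma bounded_observable_scaled_entry [intro]:
  assumes "i < N" "j < N" shows "bounded_observable N (scaled_entry N i j)"
proof -
  have "bounded_observable N (\<lambda>A. A $$ (i, j))"
    using assms entry_measurable orthogonal_entry_bound unfolding bounded_observable_def by blast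
  from bounded_observable_mult[OF bounded_observable_const this]
  show ?thesis by (simp add: scaled_entry_def [abs_def])
qed

lemma scaled_entry_columns:
  assumes "A \<in> orthogonal_group N" "j < N" "l < N"
  shows "(\<Sum>b<N. scaled_entry N b j A * scaled_entry N b l A) = (if j = l then real N else 0)"
proof -
  have "(\<Sum>b<N. scaled_entry N b j A * scaled_entry N b l A) = real N * (\<Sum>b<N. A $$ (b, j) * A $$ (b, l))"
    unfolding sum_distrib_left
  proof (rule sum.cong[OF refl])
    fix b
    have "scaled_entry N b j A * scaled_entry N b l A
        = (sqrt (real N) * sqrt (real N)) * (A $$ (b, j) * A $$ (b, l))"
      unfolding scaled_entry_def by (simp only: ac_simps)
    thus "scaled_entry N b j A * scaled_entry N b l A = real N * (A $$ (b, j) * A $$ (b, l))"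
      by simp
  qed
  thus ?thesis using orthogonal_columns[OF assms] by simp
qed

section \<open>Differentiation along rotations\<close>

definition lipschitz_along :: "nat \<Rightarrow> nat \<Rightarrow> nat \<Rightarrow> (real mat \<Rightarrow> real) \<Rightarrow> bool" where
  "lipschitz_along N a b \<phi> \<longleftrightarrow> (\<exists>C. \<forall>A \<in> orthogonal_group N. \<forall>\<theta>.
      \<bar>\<phi> (plane_rotation N a b \<theta> * A) - \<phi> A\<bar> \<le> C * \<bar>\<theta>\<bar>)"

text \<open>
  If \<open>d b l\<close> is the partial derivative in the rescaled entry at \<open>(b, l)\<close>, this is the chain rule for
  the rotation of rows \<open>a\<close> and \<open>b\<close> at angle \<open>0\<close>: it moves row \<open>a\<close> in the direction of row \<open>b\<close> and row
  \<open>b\<close> in the direction opposite to row \<open>a\<close>.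
\<close>
definition rotation_derivative ::
    "nat \<Rightarrow> (nat \<Rightarrow> nat \<Rightarrow> real mat \<Rightarrow> real) \<Rightarrow> nat \<Rightarrow> nat \<Rightarrow> real mat \<Rightarrow> real" where
  "rotation_derivative N d a b A =
     (\<Sum>l<N. scaled_entry N b l A * d a l A - scaled_entry N a l A * d b l A)"

text \<open>
  The gradient \<open>d\<close> is a parameter and not derived from \<open>\<phi>\<close>, because \<open>\<phi>\<close> matters only on the
  group, where the entries are not independent coordinates and many choices of \<open>d\<close> describe the same
  derivatives along rotations. The Lipschitz bound, uniform on the group, is what dominated
  convergence needs. The closure properties that follow cover all polynomials in the entries.
\<close>
definition smooth_observable ::
    "nat \<Rightarrow> (real mat \<Rightarrow> real) \<Rightarrow> (nat \<Rightarrow> nat \<Rightarrow> real mat \<Rightarrow> real) \<Rightarrow> bool" where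
  "smooth_observable N \<phi> d \<longleftrightarrow>
     bounded_observable N \<phi> \<and>
     (\<forall>i<N. \<forall>j<N. bounded_observable N (d i j)) \<and>
     (\<forall>a<N. \<forall>b<N. a \<noteq> b \<longrightarrow> lipschitz_along N a b \<phi> \<and>
        (\<forall>A \<in> orthogonal_group N.
           ((\<lambda>\<theta>. \<phi> (plane_rotation N a b \<theta> * A)) has_real_derivative rotation_derivative N d a b A) (at 0)))"

lemma plane_rotation_0_mult:
  assumes "A \<in> orthogonal_group N" "a < N" "b < N" "a \<noteq> b"
  shows "plane_rotation N a b 0 * A = A"
proof (rule eq_matI)
  fix i j assume "i < dim_row A" "j < dim_col A"
  thus "(plane_rotation N a b 0 * A) $$ (i, j) = A $$ (i, j)"
    using assms by (subst plane_rotation_mult_index) (auto simp: orthogonal_group_def)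
qed (use assms in \<open>auto simp: orthogonal_group_def plane_rotation_def\<close>)

lemma smooth_observable_bounded:
  assumes "smooth_observable N \<phi> d"
  shows "bounded_observable N \<phi>"
    and "i < N \<Longrightarrow> j < N \<Longrightarrow> bounded_observable N (d i j)"
  using assms by (auto simp: smooth_observable_def)

lemma smooth_observable_const [intro]: "smooth_observable N (\<lambda>_. c) (\<lambda>i j _. 0)"
  unfolding smooth_observable_def
proof (intro conjI allI impI ballI)
  fix a b
  show "lipschitz_along N a b (\<lambda>_. c)"
    unfolding lipschitz_along_def by (intro exI[of _ 0]) simp
  fix A
  have "rotation_derivative N (\<lambda>i j _. 0) a b A = 0"
    by (simp add: rotation_derivative_def)
  thus "((\<lambda>\<theta>. c) has_real_derivative rotation_derivative N (\<lambda>i j _. 0) a b A) (at 0)"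
    by (simp only: DERIV_const)
qed (rule bounded_observable_const)+

lemma smooth_observable_add [intro]:
  assumes "smooth_observable N f d" "smooth_observable N g e"
  shows "smooth_observable N (\<lambda>A. f A + g A) (\<lambda>i j A. d i j A + e i j A)"
  unfolding smooth_observable_def
proof (intro conjI allI impI ballI)
  show "bounded_observable N (\<lambda>A. f A + g A)"
    using assms by (auto simp: smooth_observable_def)
  show "bounded_observable N (\<lambda>A. d i j A + e i j A)" if "i < N" "j < N" for i j
    using smooth_observable_bounded[OF assms(1)] smooth_observable_bounded[OF assms(2)] that
    by (intro bounded_observable_add)
  fix a b assume ab: "a < N" "b < N" "a \<noteq> b"
  let ?R = "plane_rotation N a b"
  have "lipschitz_along N a b f" "lipschitz_along N a b g"
    using assms ab unfolding smooth_observable_def by metis+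
  then obtain B C where
    B: "\<forall>A \<in> orthogonal_group N. \<forall>\<theta>. \<bar>f (?R \<theta> * A) - f A\<bar> \<le> B * \<bar>\<theta>\<bar>" and
    C: "\<forall>A \<in> orthogonal_group N. \<forall>\<theta>. \<bar>g (?R \<theta> * A) - g A\<bar> \<le> C * \<bar>\<theta>\<bar>"
    unfolding lipschitz_along_def by metis
  show "lipschitz_along N a b (\<lambda>A. f A + g A)"
    unfolding lipschitz_along_def
  proof (intro exI[of _ "B + C"] ballI allI)
    fix A \<theta> assume "A \<in> orthogonal_group N"
    with B C have "\<bar>f (?R \<theta> * A) - f A\<bar> \<le> B * \<bar>\<theta>\<bar>" "\<bar>g (?R \<theta> * A) - g A\<bar> \<le> C * \<bar>\<theta>\<bar>" by auto
    thus "\<bar>f (?R \<theta> * A) + g (?R \<theta> * A) - (f A + g A)\<bar> \<le> (B + C) * \<bar>\<theta>\<bar>"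
      by (simp add: algebra_simps abs_if split: if_splits)
  qed
  fix A assume A: "A \<in> orthogonal_group N"
  have "rotation_derivative N (\<lambda>i j A. d i j A + e i j A) a b A
      = rotation_derivative N d a b A + rotation_derivative N e a b A"
    by (simp add: rotation_derivative_def algebra_simps flip: sum.distrib)
  moreover have "((\<lambda>\<theta>. f (?R \<theta> * A) + g (?R \<theta> * A)) has_real_derivative
      rotation_derivative N d a b A + rotation_derivative N e a b A) (at 0)"
    using assms ab A by (intro DERIV_add) (auto simp: smooth_observable_def)
  ultimately show "((\<lambda>\<theta>. f (?R \<theta> * A) + g (?R \<theta> * A)) has_real_derivative
      rotation_derivative N (\<lambda>i j A. d i j A + e i j A) a b A) (at 0)" by simp
qed

lemma smooth_observable_mult [intro]:
  assumes "smooth_observable N f d" "smooth_observable N g e"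
  shows "smooth_observable N (\<lambda>A. f A * g A) (\<lambda>i j A. f A * e i j A + d i j A * g A)"
  unfolding smooth_observable_def
proof (intro conjI allI impI ballI)
  show "bounded_observable N (\<lambda>A. f A * g A)"
    using assms by (auto simp: smooth_observable_def)
  show "bounded_observable N (\<lambda>A. f A * e i j A + d i j A * g A)" if "i < N" "j < N" for i j
    using smooth_observable_bounded[OF assms(1)] smooth_observable_bounded[OF assms(2)] that
    by (intro bounded_observable_add bounded_observable_mult)
  fix a b assume ab: "a < N" "b < N" "a \<noteq> b"
  let ?R = "plane_rotation N a b"
  have "lipschitz_along N a b f" "lipschitz_along N a b g"
    using assms ab unfolding smooth_observable_def by metis+
  then obtain B C where
    B: "\<forall>A \<in> orthogonal_group N. \<forall>\<theta>. \<bar>f (?R \<theta> * A) - f A\<bar> \<le> B * \<bar>\<theta>\<bar>" and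
    C: "\<forall>A \<in> orthogonal_group N. \<forall>\<theta>. \<bar>g (?R \<theta> * A) - g A\<bar> \<le> C * \<bar>\<theta>\<bar>"
    unfolding lipschitz_along_def by metis
  from assms obtain F G where
    F: "\<forall>A \<in> orthogonal_group N. \<bar>f A\<bar> \<le> F" and G: "\<forall>A \<in> orthogonal_group N. \<bar>g A\<bar> \<le> G"
    by (auto simp: smooth_observable_def bounded_observable_def)
  show "lipschitz_along N a b (\<lambda>A. f A * g A)"
    unfolding lipschitz_along_def
  proof (intro exI[of _ "\<bar>F\<bar> * C + B * \<bar>G\<bar>"] ballI allI)
    fix A \<theta> assume A: "A \<in> orthogonal_group N"
    have RA: "?R \<theta> * A \<in> orthogonal_group N"
      using A ab by (intro orthogonal_group_mult plane_rotation_orthogonal)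
    have "f (?R \<theta> * A) * g (?R \<theta> * A) - f A * g A
        = f (?R \<theta> * A) * (g (?R \<theta> * A) - g A) + (f (?R \<theta> * A) - f A) * g A"
      by (simp add: algebra_simps)
    also have "\<bar>\<dots>\<bar> \<le> \<bar>f (?R \<theta> * A)\<bar> * \<bar>g (?R \<theta> * A) - g A\<bar> + \<bar>f (?R \<theta> * A) - f A\<bar> * \<bar>g A\<bar>"
      by (metis abs_mult abs_triangle_ineq)
    also have "\<dots> \<le> \<bar>F\<bar> * (C * \<bar>\<theta>\<bar>) + (B * \<bar>\<theta>\<bar>) * \<bar>G\<bar>"
    proof (intro add_mono mult_mono)
      show "\<bar>f (?R \<theta> * A)\<bar> \<le> \<bar>F\<bar>" "\<bar>g A\<bar> \<le> \<bar>G\<bar>" using F G A RA by force+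
      show "\<bar>g (?R \<theta> * A) - g A\<bar> \<le> C * \<bar>\<theta>\<bar>" "\<bar>f (?R \<theta> * A) - f A\<bar> \<le> B * \<bar>\<theta>\<bar>" using B C A by auto
      thus "0 \<le> B * \<bar>\<theta>\<bar>" by linarith
    qed auto
    finally show "\<bar>f (?R \<theta> * A) * g (?R \<theta> * A) - f A * g A\<bar> \<le> (\<bar>F\<bar> * C + B * \<bar>G\<bar>) * \<bar>\<theta>\<bar>"
      by (simp add: algebra_simps)
  qed
  fix A assume A: "A \<in> orthogonal_group N"
  have "rotation_derivative N (\<lambda>i j A. f A * e i j A + d i j A * g A) a b A
      = f A * rotation_derivative N e a b A + rotation_derivative N d a b A * g A"
    unfolding rotation_derivative_def sum_distrib_left sum_distrib_right
    by (simp add: algebra_simps flip: sum.distrib)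
  moreover have "((\<lambda>\<theta>. f (?R \<theta> * A) * g (?R \<theta> * A)) has_real_derivative
      f (?R 0 * A) * rotation_derivative N e a b A + rotation_derivative N d a b A * g (?R 0 * A)) (at 0)"
    using assms ab A by (intro DERIV_mult') (auto simp: smooth_observable_def)
  ultimately show "((\<lambda>\<theta>. f (?R \<theta> * A) * g (?R \<theta> * A)) has_real_derivative
      rotation_derivative N (\<lambda>i j A. f A * e i j A + d i j A * g A) a b A) (at 0)"
    using A ab by (simp add: plane_rotation_0_mult)
qed

text \<open>
  The closure rules produce functions and gradients that are equal to the intended ones only after
  algebraic simplification.
\<close>
lemma smooth_observable_cong:
  assumes "smooth_observable N f d" "\<And>A. f A = g A" "\<And>i j A. d i j A = e i j A"
  shows "smooth_observable N g e"
proof -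
  have "f = g" "d = e" using assms by (auto simp: fun_eq_iff)
  thus ?thesis using assms by simp
qed

lemma smooth_observable_power [intro]:
  assumes "smooth_observable N f d"
  shows "smooth_observable N (\<lambda>A. f A ^ n) (\<lambda>i j A. real n * f A ^ (n - 1) * d i j A)"
proof (induction n)
  case 0
  show ?case by (rule smooth_observable_cong[OF smooth_observable_const]) auto
next
  case (Suc n)
  show ?case
    by (rule smooth_observable_cong[OF smooth_observable_mult[OF assms Suc]], simp)
       (cases n; simp add: algebra_simps)
qed

lemma smooth_observable_sum [intro]:
  assumes "\<And>x. x \<in> S \<Longrightarrow> smooth_observable N (f x) (d x)"
  shows "smooth_observable N (\<lambda>A. \<Sum>x\<in>S. f x A) (\<lambda>i j A. \<Sum>x\<in>S. d x i j A)"
  using assms by (induction S rule: infinite_finite_induct) auto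

lemma smooth_observable_scale [intro]:
  assumes "smooth_observable N f d"
  shows "smooth_observable N (\<lambda>A. c * f A) (\<lambda>i j A. c * d i j A)"
  by (rule smooth_observable_cong[OF smooth_observable_mult[OF smooth_observable_const assms, of c]]) auto

lemma smooth_observable_scaled_entry:
  assumes ij: "i < N" "j < N"
  shows "smooth_observable N (scaled_entry N i j) (\<lambda>r l _. if r = i \<and> l = j then 1 else 0)"
  unfolding smooth_observable_def
proof (intro conjI allI impI ballI)
  show "bounded_observable N (scaled_entry N i j)" using ij by auto
  fix a b assume ab: "a < N" "b < N" "a \<noteq> b"
  let ?R = "plane_rotation N a b"
  have rot: "scaled_entry N i j (?R \<theta> * A) =
      (if i = a then cos \<theta> * scaled_entry N a j A + sin \<theta> * scaled_entry N b j A
       else if i = b then cos \<theta> * scaled_entry N b j A - sin \<theta> * scaled_entry N a j A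
       else scaled_entry N i j A)" if "A \<in> orthogonal_group N" for A \<theta>
  proof -
    have "A \<in> carrier_mat N N" using that by (auto simp: orthogonal_group_def)
    thus ?thesis unfolding scaled_entry_def
      using ab ij by (subst plane_rotation_mult_index) (auto simp: algebra_simps)
  qed
  have cosb: "\<bar>cos \<theta> - 1\<bar> \<le> \<bar>\<theta>\<bar>" for \<theta> :: real
  proof -
    have "\<bar>cos \<theta> - 1\<bar> = 2 * (\<bar>sin (\<theta> / 2)\<bar> * \<bar>sin (\<theta> / 2)\<bar>)"
      using cos_double_sin[of "\<theta> / 2"] by (simp add: power2_eq_square abs_mult)
    also have "\<dots> \<le> 2 * (\<bar>\<theta> / 2\<bar> * 1)"
      by (intro mult_left_mono mult_mono abs_sin_x_le_abs_x) auto
    finally show ?thesis by simp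
  qed
  show "lipschitz_along N a b (scaled_entry N i j)"
    unfolding lipschitz_along_def
  proof (intro exI[of _ "2 * sqrt (real N)"] ballI allI)
    fix A \<theta> assume A: "A \<in> orthogonal_group N"
    have e: "\<bar>scaled_entry N r j A\<bar> \<le> sqrt (real N)" if "r < N" for r
      using orthogonal_entry_bound[OF A that ij(2)]
      by (auto simp: scaled_entry_def abs_mult intro!: mult_left_le)
    have *: "\<bar>(cos \<theta> - 1) * x + sin \<theta> * y\<bar> \<le> 2 * sqrt (real N) * \<bar>\<theta>\<bar>"
      if "\<bar>x\<bar> \<le> sqrt (real N)" "\<bar>y\<bar> \<le> sqrt (real N)" for x y
    proof -
      have "\<bar>(cos \<theta> - 1) * x + sin \<theta> * y\<bar> \<le> \<bar>cos \<theta> - 1\<bar> * \<bar>x\<bar> + \<bar>sin \<theta>\<bar> * \<bar>y\<bar>"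
        by (metis abs_mult abs_triangle_ineq)
      also have "\<dots> \<le> \<bar>\<theta>\<bar> * sqrt (real N) + \<bar>\<theta>\<bar> * sqrt (real N)"
        using that by (intro add_mono mult_mono cosb abs_sin_x_le_abs_x) auto
      finally show ?thesis by (simp add: mult_ac)
    qed
    have "\<bar>- scaled_entry N a j A\<bar> \<le> sqrt (real N)" using e[OF ab(1)] by simp
    from *[OF e[OF ab(2)] this] *[OF e[OF ab(1)] e[OF ab(2)]] A
    show "\<bar>scaled_entry N i j (?R \<theta> * A) - scaled_entry N i j A\<bar> \<le> 2 * sqrt (real N) * \<bar>\<theta>\<bar>"
      by (auto simp: rot algebra_simps)
  qed
  fix A assume A: "A \<in> orthogonal_group N"
  have "rotation_derivative N (\<lambda>r l _. if r = i \<and> l = j then 1 else 0) a b A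
     = (\<Sum>l<N. if l = j then (if i = a then scaled_entry N b j A else 0)
           - (if i = b then scaled_entry N a j A else 0) else 0)"
    unfolding rotation_derivative_def by (intro sum.cong) auto
  also have "\<dots> = (if i = a then scaled_entry N b j A else if i = b then - scaled_entry N a j A else 0)"
    using ij ab by simp
  finally show "((\<lambda>\<theta>. scaled_entry N i j (?R \<theta> * A)) has_real_derivative
      rotation_derivative N (\<lambda>r l _. if r = i \<and> l = j then 1 else 0) a b A) (at 0)"
    using A ab by (auto simp: rot intro!: derivative_eq_intros)
qed auto

lemma smooth_observable_poly:
  fixes p :: "real poly"
  assumes "smooth_observable N f d"
  shows "smooth_observable N (\<lambda>A. poly p (f A)) (\<lambda>i j A. poly (pderiv p) (f A) * d i j A)"
proof (induction p)
  case 0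
  show ?case by (rule smooth_observable_cong[OF smooth_observable_const]) auto
next
  case (pCons c p)
  show ?case
    by (rule smooth_observable_cong[OF smooth_observable_add[OF smooth_observable_const
          smooth_observable_mult[OF assms pCons.IH], of c]])
       (auto simp: pderiv_pCons algebra_simps)
qed

section \<open>Integration by parts for the Haar measure\<close>

locale haar_orthogonal = prob_space \<mu> for \<mu> :: "real mat measure" +
  fixes N :: nat
  assumes haar: "haar_probability N \<mu>" and N_pos: "N \<ge> 1"
begin

lemma sets_eq: "sets \<mu> = sets (orthogonal_borel N)" and space_eq: "space \<mu> = orthogonal_group N"
  using haar by (auto simp: haar_probability_def)

lemma observable_integrable [intro]:
  assumes "bounded_observable N f" shows "integrable \<mu> f"
proof -
  from assms obtain B where "\<forall>A \<in> orthogonal_group N. \<bar>f A\<bar> \<le> B" and m: "f \<in> borel_measurable (orthogonal_borel N)"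
    by (auto simp: bounded_observable_def)
  moreover have "f \<in> borel_measurable \<mu>" using m by (simp add: measurable_cong_sets[OF sets_eq refl])
  ultimately show ?thesis
    by (intro integrable_const_bound[of f B]) (auto simp: space_eq)
qed

lemma expectation_left_mult:
  assumes "U \<in> orthogonal_group N" and "bounded_observable N f"
  shows "expectation (\<lambda>A. f (U * A)) = expectation f"
proof -
  have "expectation f = (\<integral>A. f A \<partial>distr \<mu> (orthogonal_borel N) (\<lambda>A. U * A))"
    using haar assms by (auto simp: haar_probability_def)
  also have "\<dots> = expectation (\<lambda>A. f (U * A))"
    using assms left_mult_measurable[OF assms(1)]
    by (intro integral_distr) (auto simp: bounded_observable_def measurable_cong_sets[OF sets_eq refl])
  finally show ?thesis ..
qed

lemma rotation_derivative_observable: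
  assumes "smooth_observable N \<phi> d" "a < N" "b < N"
  shows "bounded_observable N (rotation_derivative N d a b)"
  unfolding rotation_derivative_def[abs_def] using assms
  by (intro bounded_observable_sum bounded_observable_diff bounded_observable_mult)
     (auto simp: smooth_observable_def)

text \<open>
  By invariance, \<open>\<phi>\<close> has the same expectation before and after a rotation, so every difference
  quotient in the angle has expectation \<open>0\<close>; the Lipschitz bound dominates the quotients.
\<close>
lemma expectation_rotation_derivative:
  assumes \<phi>: "smooth_observable N \<phi> d" and ab: "a < N" "b < N" "a \<noteq> b"
  shows "expectation (rotation_derivative N d a b) = 0"
proof -
  let ?R = "plane_rotation N a b"
  define D where "D n A = (\<phi> (?R (1 / Suc n) * A) - \<phi> A) * real (Suc n)" for n A
  have obs: "bounded_observable N \<phi>" using \<phi> by (simp add: smooth_observable_def)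
  have R: "?R \<theta> \<in> orthogonal_group N" for \<theta> using ab by (rule plane_rotation_orthogonal)
  have obsR: "bounded_observable N (\<lambda>A. \<phi> (?R \<theta> * A))" for \<theta>
    using obs left_mult_measurable[OF R, of \<theta>] orthogonal_group_mult[OF R, of _ \<theta>]
    unfolding bounded_observable_def by (auto intro: measurable_compose)
  have D0: "expectation (D n) = 0" for n
    unfolding D_def[abs_def] using obs obsR expectation_left_mult[OF R obs]
    by (simp add: Bochner_Integration.integral_diff observable_integrable)
  have "lipschitz_along N a b \<phi>" using \<phi> ab unfolding smooth_observable_def by metis
  then obtain C where C: "\<And>A \<theta>. A \<in> orthogonal_group N \<Longrightarrow> \<bar>\<phi> (?R \<theta> * A) - \<phi> A\<bar> \<le> C * \<bar>\<theta>\<bar>"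
    unfolding lipschitz_along_def by metis
  have "(\<lambda>n. expectation (D n)) \<longlonglongrightarrow> expectation (rotation_derivative N d a b)"
  proof (rule integral_dominated_convergence[where w = "\<lambda>_. C"])
    show "rotation_derivative N d a b \<in> borel_measurable \<mu>"
      using observable_integrable[OF rotation_derivative_observable[OF \<phi> ab(1,2)]] by auto
    show "D n \<in> borel_measurable \<mu>" for n
    proof (rule borel_measurable_integrable, rule observable_integrable)
      show "bounded_observable N (D n)"
        unfolding D_def[abs_def]
        by (rule bounded_observable_mult[OF bounded_observable_diff[OF obsR obs] bounded_observable_const])
    qed
    show "AE A in \<mu>. (\<lambda>n. D n A) \<longlonglongrightarrow> rotation_derivative N d a b A"
    proof (rule AE_I2)
      fix A assume "A \<in> space \<mu>"
      hence A: "A \<in> orthogonal_group N" by (simp add: space_eq)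
      have "((\<lambda>\<theta>. \<phi> (?R \<theta> * A)) has_real_derivative rotation_derivative N d a b A) (at 0)"
        using \<phi> ab A by (auto simp: smooth_observable_def)
      hence "((\<lambda>\<theta>. (\<phi> (?R \<theta> * A) - \<phi> A) / \<theta>) \<longlongrightarrow> rotation_derivative N d a b A) (at 0)"
        by (simp add: DERIV_def plane_rotation_0_mult[OF A ab])
      moreover have "filterlim (\<lambda>n. 1 / real (Suc n)) (at 0) sequentially"
        using LIMSEQ_inverse_real_of_nat by (auto simp: filterlim_at inverse_eq_divide)
      ultimately have "(\<lambda>n. (\<phi> (?R (1 / real (Suc n)) * A) - \<phi> A) / (1 / real (Suc n))) \<longlonglongrightarrow> rotation_derivative N d a b A"
        by (rule filterlim_compose)
      thus "(\<lambda>n. D n A) \<longlonglongrightarrow> rotation_derivative N d a b A" by (simp add: D_def)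
    qed
    show "AE A in \<mu>. norm (D n A) \<le> C" for n
    proof (rule AE_I2)
      fix A assume "A \<in> space \<mu>"
      hence "\<bar>\<phi> (?R (1 / Suc n) * A) - \<phi> A\<bar> * real (Suc n) \<le> C * \<bar>1 / Suc n\<bar> * real (Suc n)"
        using C[of A "1 / Suc n"] by (intro mult_right_mono) (auto simp: space_eq)
      thus "norm (D n A) \<le> C" by (simp add: D_def abs_mult del: of_nat_Suc)
    qed
  qed auto
  thus ?thesis using D0 by (simp add: LIMSEQ_const_iff)
qed

text \<open>
  Apply the vanishing of rotation derivatives to \<open>y b j * \<phi>\<close> and the rows \<open>i\<close> and \<open>b\<close>. The factor
  \<open>y b j\<close> differentiates to \<open>- y i j\<close>, which yields \<open>- y i j * \<phi>\<close> once for each \<open>b \<noteq> i\<close>. The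
  remaining terms vanish for \<open>b = i\<close>, so they can be summed over all \<open>b\<close>, and
  \<open>\<Sum>b. y b l * y b j\<close> is \<open>N\<close> or \<open>0\<close> by orthonormality of the columns.
\<close>
lemma stein_identity:
  assumes \<phi>: "smooth_observable N \<phi> d" and ij: "i < N" "j < N"
  shows "(real N - 1) * expectation (\<lambda>A. scaled_entry N i j A * \<phi> A) =
    expectation (\<lambda>A. real N * d i j A -
      (\<Sum>b<N. \<Sum>l<N. scaled_entry N i l A * scaled_entry N b j A * d b l A))"
proof -
  let ?y = "scaled_entry N"
  have d: "bounded_observable N (d a b)" if "a < N" "b < N" for a b
    using \<phi> that by (auto simp: smooth_observable_def)
  have obs: "bounded_observable N \<phi>" using \<phi> by (simp add: smooth_observable_def)
  \<comment> \<open>The part of the rotation derivative of \<open>y b j * \<phi>\<close> that contains derivatives of \<open>\<phi>\<close>.\<close>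
  define T where "T b A = (\<Sum>l<N. ?y b l A * ?y b j A * d i l A - ?y i l A * ?y b j A * d b l A)" for b A
  have T_obs: "bounded_observable N (T b)" if "b < N" for b
    unfolding T_def[abs_def] using that ij d
    by (intro bounded_observable_sum bounded_observable_diff bounded_observable_mult) auto
  have step: "expectation (T b) = expectation (\<lambda>A. ?y i j A * \<phi> A)" if b: "b < N" "b \<noteq> i" for b
  proof -
    define e where "e r l A = ?y b j A * d r l A + (if r = b \<and> l = j then 1 else 0) * \<phi> A" for r l A
    have "smooth_observable N (\<lambda>A. ?y b j A * \<phi> A) e"
      unfolding e_def[abs_def]
      by (rule smooth_observable_mult[OF smooth_observable_scaled_entry \<phi>]) (use b ij in auto)
    hence "expectation (rotation_derivative N e i b) = 0"
      using b ij by (intro expectation_rotation_derivative) auto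
    also have "rotation_derivative N e i b = (\<lambda>A. T b A - ?y i j A * \<phi> A)"
    proof
      fix A
      have "rotation_derivative N e i b A = (\<Sum>l<N. (?y b l A * ?y b j A * d i l A - ?y i l A * ?y b j A * d b l A)
          - (if l = j then ?y i j A * \<phi> A else 0))"
        unfolding rotation_derivative_def e_def using b by (intro sum.cong) (auto simp: algebra_simps)
      also have "\<dots> = T b A - ?y i j A * \<phi> A"
        unfolding T_def sum_subtractf using ij by simp
      finally show "rotation_derivative N e i b A = T b A - ?y i j A * \<phi> A" .
    qed
    also have "expectation \<dots> = expectation (T b) - expectation (\<lambda>A. ?y i j A * \<phi> A)"
      using T_obs[OF b(1)] obs ij by (intro Bochner_Integration.integral_diff) auto
    finally show ?thesis by simp
  qed
  \<comment> \<open>The sum over \<open>b \<noteq> i\<close> has \<open>N - 1\<close> equal terms, and \<open>b = i\<close> contributes nothing.\<close>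
  have Ti: "T i = (\<lambda>_. 0)" by (simp add: T_def fun_eq_iff)
  have "(\<Sum>b<N. expectation (T b)) = (\<Sum>b\<in>{..<N} - {i}. expectation (\<lambda>A. ?y i j A * \<phi> A))"
    using ij Ti by (subst sum.remove[of _ i]) (auto simp: step)
  also have "\<dots> = (real N - 1) * expectation (\<lambda>A. ?y i j A * \<phi> A)"
    using ij by (simp add: of_nat_diff)
  finally have "(real N - 1) * expectation (\<lambda>A. ?y i j A * \<phi> A) = (\<Sum>b<N. expectation (T b))" ..
  also have "\<dots> = expectation (\<lambda>A. \<Sum>b<N. T b A)"
    using T_obs by (intro Bochner_Integration.integral_sum[symmetric]) auto
  also have "\<dots> = expectation (\<lambda>A. real N * d i j A -
      (\<Sum>b<N. \<Sum>l<N. ?y i l A * ?y b j A * d b l A))"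
  proof (rule Bochner_Integration.integral_cong[OF refl])
    fix A assume "A \<in> space \<mu>"
    hence A: "A \<in> orthogonal_group N" by (simp add: space_eq)
    have "(\<Sum>b<N. \<Sum>l<N. ?y b l A * ?y b j A * d i l A) = (\<Sum>l<N. (\<Sum>b<N. ?y b l A * ?y b j A) * d i l A)"
      by (subst sum.swap) (simp add: sum_distrib_right)
    also have "\<dots> = (\<Sum>l<N. if l = j then real N * d i j A else 0)"
      using A ij by (intro sum.cong) (auto simp: scaled_entry_columns)
    also have "\<dots> = real N * d i j A" using ij by simp
    finally show "(\<Sum>b<N. T b A) = real N * d i j A - (\<Sum>b<N. \<Sum>l<N. ?y i l A * ?y b j A * d b l A)"
      unfolding T_def sum_subtractf by simp
  qed
  finally show ?thesis .
qed

end

text \<open>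
  The form as a single expectation, in which the integrand can be rewritten pointwise.
\<close>
lemma (in haar_orthogonal) stein_identity_zero:
  assumes \<phi>: "smooth_observable N \<phi> d" and ij: "i < N" "j < N"
  shows "expectation (\<lambda>A. (real N - 1) * (scaled_entry N i j A * \<phi> A) - (real N * d i j A -
      (\<Sum>b<N. \<Sum>l<N. scaled_entry N i l A * scaled_entry N b j A * d b l A))) = 0"
proof -
  have "bounded_observable N (\<lambda>A. (real N - 1) * (scaled_entry N i j A * \<phi> A))"
    using smooth_observable_bounded(1)[OF \<phi>] ij
    by (intro bounded_observable_mult bounded_observable_const bounded_observable_scaled_entry)
  moreover have "bounded_observable N (\<lambda>A. real N * d i j A -
      (\<Sum>b<N. \<Sum>l<N. scaled_entry N i l A * scaled_entry N b j A * d b l A))"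
    using smooth_observable_bounded(2)[OF \<phi>] ij
    by (intro bounded_observable_diff bounded_observable_sum bounded_observable_mult
        bounded_observable_const bounded_observable_scaled_entry) auto
  ultimately show ?thesis
    using stein_identity[OF assms]
    by (simp add: Bochner_Integration.integral_diff[OF observable_integrable observable_integrable])
qed

section \<open>Moments of a single entry\<close>

text \<open>
  The integration by parts formula for \<open>\<phi> = y ^ (2 * n + 1)\<close> is the exact recurrence
  \<open>(N + 2 * n) * E y ^ (2 * n + 2) = N * (2 * n + 1) * E y ^ (2 * n)\<close>.
\<close>
lemma (in haar_orthogonal) even_moment_step:
  assumes ij: "i < N" "j < N"
  shows "expectation (\<lambda>A. scaled_entry N i j A ^ (2 * n + 2))
     \<le> (2 * real n + 1) * expectation (\<lambda>A. scaled_entry N i j A ^ (2 * n))"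
proof -
  let ?y = "scaled_entry N i j"
  define d where "d b l A = real (2 * n + 1) * ?y A ^ (2 * n + 1 - 1) * (if b = i \<and> l = j then 1 else 0)" for b l A
  have d: "smooth_observable N (\<lambda>A. ?y A ^ (2 * n + 1)) d"
    unfolding d_def[abs_def] by (rule smooth_observable_power[OF smooth_observable_scaled_entry[OF ij]])
  have obs: "bounded_observable N (\<lambda>A. ?y A ^ r)" for r
    using ij by (intro bounded_observable_power bounded_observable_scaled_entry)
  have pt: "(real N - 1) * (?y A * ?y A ^ (2 * n + 1)) - (real N * d i j A -
      (\<Sum>b<N. \<Sum>l<N. scaled_entry N i l A * scaled_entry N b j A * d b l A))
    = (real N + 2 * real n) * ?y A ^ (2 * n + 2) - real N * (2 * real n + 1) * ?y A ^ (2 * n)" for A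
  proof -
    have "(\<Sum>b<N. \<Sum>l<N. scaled_entry N i l A * scaled_entry N b j A * d b l A)
       = (\<Sum>b<N. if b = i then (\<Sum>l<N. if l = j then ?y A * ?y A * (real (2 * n + 1) * ?y A ^ (2 * n)) else 0) else 0)"
    proof (intro sum.cong refl)
      fix b
      have "(\<Sum>l<N. scaled_entry N i l A * scaled_entry N b j A * d b l A)
        = (\<Sum>l<N. if l = j then (if b = i then ?y A * ?y A * (real (2 * n + 1) * ?y A ^ (2 * n)) else 0) else 0)"
        by (intro sum.cong) (auto simp: d_def)
      thus "(\<Sum>l<N. scaled_entry N i l A * scaled_entry N b j A * d b l A)
        = (if b = i then (\<Sum>l<N. if l = j then ?y A * ?y A * (real (2 * n + 1) * ?y A ^ (2 * n)) else 0) else 0)"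
        by auto
    qed
    also have "\<dots> = real (2 * n + 1) * ?y A ^ (2 * n + 2)"
      using ij by simp
    finally show ?thesis by (simp add: d_def algebra_simps)
  qed
  have "0 = expectation (\<lambda>A. (real N + 2 * real n) * ?y A ^ (2 * n + 2) - real N * (2 * real n + 1) * ?y A ^ (2 * n))"
    using stein_identity_zero[OF d ij] unfolding pt by simp
  also have "\<dots> = (real N + 2 * real n) * expectation (\<lambda>A. ?y A ^ (2 * n + 2))
      - real N * (2 * real n + 1) * expectation (\<lambda>A. ?y A ^ (2 * n))"
    using observable_integrable[OF obs] by (subst Bochner_Integration.integral_diff) (auto simp del: power_Suc)
  finally have eq: "(real N + 2 * real n) * expectation (\<lambda>A. ?y A ^ (2 * n + 2))
      = real N * (2 * real n + 1) * expectation (\<lambda>A. ?y A ^ (2 * n))" by simp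
  have nn: "0 \<le> expectation (\<lambda>A. ?y A ^ (2 * n + 2))"
    by (intro integral_nonneg_AE AE_I2 zero_le_even_power) simp
  have "real N * expectation (\<lambda>A. ?y A ^ (2 * n + 2)) \<le> (real N + 2 * real n) * expectation (\<lambda>A. ?y A ^ (2 * n + 2))"
    using nn by (intro mult_right_mono) auto
  hence "real N * expectation (\<lambda>A. ?y A ^ (2 * n + 2)) \<le> real N * ((2 * real n + 1) * expectation (\<lambda>A. ?y A ^ (2 * n)))"
    unfolding eq by (simp add: mult.assoc)
  thus ?thesis using N_pos by simp
qed

text \<open>
  The bound is the corresponding moment of the standard Gaussian.
\<close>
lemma (in haar_orthogonal) even_moment_bound:
  assumes ij: "i < N" "j < N"
  shows "expectation (\<lambda>A. scaled_entry N i j A ^ (2 * n)) \<le> (\<Prod>t<n. 2 * real t + 1)"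
proof (induction n)
  case 0
  show ?case by (simp add: prob_space)
next
  case (Suc n)
  have "expectation (\<lambda>A. scaled_entry N i j A ^ (2 * Suc n))
      \<le> (2 * real n + 1) * expectation (\<lambda>A. scaled_entry N i j A ^ (2 * n))"
    using even_moment_step[OF ij, of n] by simp
  also have "\<dots> \<le> (2 * real n + 1) * (\<Prod>t<n. 2 * real t + 1)"
    using Suc by (intro mult_left_mono) auto
  finally show ?case by (simp add: mult.commute)
qed

text \<open>
  What matters about this bound is that it depends on the polynomial only, and neither on the dimension
  nor on the position of the entry. It combines \<open>\<bar>y ^ r\<bar> \<le> 1 + y ^ (2 * r)\<close> with the bound on the
  even moments.
\<close>
definition poly_moment_bound :: "real poly \<Rightarrow> real" where
  "poly_moment_bound P = (\<Sum>r\<le>degree P. \<bar>coeff P r\<bar> * (1 + (\<Prod>t<r. 2 * real t + 1)))"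

lemma (in haar_orthogonal) expectation_poly_le:
  assumes ij: "i < N" "j < N"
  shows "expectation (\<lambda>A. poly P (scaled_entry N i j A)) \<le> poly_moment_bound P"
proof -
  let ?y = "scaled_entry N i j"
  have obs: "bounded_observable N (\<lambda>A. ?y A ^ r)" for r
    using ij by (intro bounded_observable_power bounded_observable_scaled_entry)
  have pt: "poly P (?y A) \<le> (\<Sum>r\<le>degree P. \<bar>coeff P r\<bar> * (1 + ?y A ^ (2 * r)))" for A
    unfolding poly_altdef
  proof (rule sum_mono)
    fix r
    have "\<bar>?y A ^ r\<bar> \<le> 1 + ?y A ^ (2 * r)"
    proof -
      have "0 \<le> (\<bar>?y A ^ r\<bar> - 1)\<^sup>2 + \<bar>?y A ^ r\<bar>" by simp
      also have "\<dots> = \<bar>?y A ^ r\<bar>\<^sup>2 + 1 - \<bar>?y A ^ r\<bar>" by (simp add: power2_diff)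
      also have "\<bar>?y A ^ r\<bar>\<^sup>2 = ?y A ^ (2 * r)" by (simp add: power_mult[symmetric] mult.commute)
      finally show ?thesis by simp
    qed
    hence "\<bar>coeff P r * ?y A ^ r\<bar> \<le> \<bar>coeff P r\<bar> * (1 + ?y A ^ (2 * r))"
      unfolding abs_mult by (intro mult_left_mono) auto
    thus "coeff P r * ?y A ^ r \<le> \<bar>coeff P r\<bar> * (1 + ?y A ^ (2 * r))" by linarith
  qed
  have obs2: "bounded_observable N (\<lambda>A. \<bar>coeff P r\<bar> * (1 + ?y A ^ (2 * r)))" for r
    by (intro bounded_observable_mult bounded_observable_add bounded_observable_const obs)
  have "expectation (\<lambda>A. poly P (?y A)) \<le> expectation (\<lambda>A. \<Sum>r\<le>degree P. \<bar>coeff P r\<bar> * (1 + ?y A ^ (2 * r)))"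
    using ij by (intro integral_mono observable_integrable pt bounded_observable_sum obs2
        bounded_observable_poly bounded_observable_scaled_entry)
  also have "\<dots> = (\<Sum>r\<le>degree P. \<bar>coeff P r\<bar> * (1 + expectation (\<lambda>A. ?y A ^ (2 * r))))"
  proof (subst Bochner_Integration.integral_sum)
    show "integrable \<mu> (\<lambda>A. \<bar>coeff P r\<bar> * (1 + ?y A ^ (2 * r)))" for r
      by (rule observable_integrable[OF obs2])
    have "expectation (\<lambda>A. 1 + ?y A ^ (2 * r)) = 1 + expectation (\<lambda>A. ?y A ^ (2 * r))" for r
      using observable_integrable[OF obs] by (subst Bochner_Integration.integral_add) (auto simp: prob_space)
    thus "(\<Sum>r\<le>degree P. expectation (\<lambda>A. \<bar>coeff P r\<bar> * (1 + ?y A ^ (2 * r))))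
      = (\<Sum>r\<le>degree P. \<bar>coeff P r\<bar> * (1 + expectation (\<lambda>A. ?y A ^ (2 * r))))" by simp
  qed
  also have "\<dots> \<le> poly_moment_bound P"
    unfolding poly_moment_bound_def
    by (intro sum_mono mult_left_mono add_left_mono even_moment_bound[OF ij]) auto
  finally show ?thesis .
qed

section \<open>Elementary inequalities\<close>

lemma average_power_le:
  fixes z :: "'a \<Rightarrow> real"
  assumes I: "finite I" "I \<noteq> {}" and z: "\<And>e. e \<in> I \<Longrightarrow> 0 \<le> z e"
  shows "((\<Sum>e\<in>I. z e) / card I) ^ q \<le> (\<Sum>e\<in>I. z e ^ q) / card I"
proof -
  have conv: "convex_on {0::real..} (\<lambda>x. x ^ q)"
    by (cases "even q") (auto intro: convex_power_odd convex_on_subset[OF convex_power_even])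
  have "(\<lambda>x. x ^ q) (\<Sum>e\<in>I. (1 / card I) *\<^sub>R z e) \<le> (\<Sum>e\<in>I. (1 / card I) * z e ^ q)"
    using I z by (intro convex_on_sum[OF _ _ conv]) auto
  thus ?thesis by (simp add: sum_divide_distrib)
qed

text \<open>
  A form of Young's inequality with a free parameter \<open>K\<close>: a large \<open>K\<close> makes the power of \<open>b\<close> small
  enough to be absorbed elsewhere. Compare \<open>b\<close> with \<open>K * a\<close>: if it is smaller, the first summand
  suffices, and otherwise the second.
\<close>
lemma young_power:
  fixes a b K :: real
  assumes "0 \<le> a" "0 \<le> b" "0 < K"
  shows "a * b ^ t \<le> K ^ t * a ^ Suc t + b ^ Suc t / K"
proof (cases "b \<le> K * a")
  case True
  have "a * b ^ t \<le> a * (K * a) ^ t"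
    using assms True by (intro mult_left_mono power_mono) auto
  also have "\<dots> = K ^ t * a ^ Suc t" by (simp add: power_mult_distrib)
  also have "\<dots> \<le> K ^ t * a ^ Suc t + b ^ Suc t / K" using assms by simp
  finally show ?thesis .
next
  case False
  hence "a \<le> b / K" using assms by (simp add: field_simps)
  hence "a * b ^ t \<le> (b / K) * b ^ t" using assms by (intro mult_right_mono) auto
  also have "\<dots> \<le> K ^ t * a ^ Suc t + b ^ Suc t / K" using assms by simp
  finally show ?thesis .
qed

lemma product4_le:
  fixes a b c d :: real
  shows "\<bar>a * b * c * d\<bar> \<le> a ^ 4 + b ^ 4 + c ^ 4 + d ^ 4"
proof -
  have two: "\<bar>x * y\<bar> \<le> (x\<^sup>2 + y\<^sup>2) / 2" for x y :: real
    using sum_squares_bound[of "\<bar>x\<bar>" "\<bar>y\<bar>"] by (simp add: abs_mult)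
  have "\<bar>a * b * c * d\<bar> = \<bar>(a * b) * (c * d)\<bar>" by (simp add: mult.assoc)
  also have "\<dots> \<le> (\<bar>a * b\<bar>\<^sup>2 + \<bar>c * d\<bar>\<^sup>2) / 2" using two[of "a * b" "c * d"] by simp
  also have "\<dots> = (\<bar>a\<^sup>2 * b\<^sup>2\<bar> + \<bar>c\<^sup>2 * d\<^sup>2\<bar>) / 2" by (simp add: power_mult_distrib)
  also have "\<dots> \<le> (((a\<^sup>2)\<^sup>2 + (b\<^sup>2)\<^sup>2) / 2 + ((c\<^sup>2)\<^sup>2 + (d\<^sup>2)\<^sup>2) / 2) / 2"
    using two[of "a\<^sup>2" "b\<^sup>2"] two[of "c\<^sup>2" "d\<^sup>2"] by (intro divide_right_mono add_mono) auto
  also have "\<dots> \<le> (a\<^sup>2)\<^sup>2 + (b\<^sup>2)\<^sup>2 + (c\<^sup>2)\<^sup>2 + (d\<^sup>2)\<^sup>2"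
    using zero_le_power2[of "a\<^sup>2"] zero_le_power2[of "b\<^sup>2"] zero_le_power2[of "c\<^sup>2"] zero_le_power2[of "d\<^sup>2"]
    by argo
  finally show ?thesis by simp
qed

section \<open>Moments of averages over the block\<close>

definition block_average :: "nat \<Rightarrow> nat \<Rightarrow> nat \<Rightarrow> (real \<Rightarrow> real) \<Rightarrow> real mat \<Rightarrow> real" where
  "block_average N m k f A =
     (\<Sum>e\<in>{..<m} \<times> {..<k}. f (scaled_entry N (fst e) (snd e) A)) / real (m * k)"

text \<open>
  The condition \<open>m * k \<le> N\<close> lets the errors of order \<open>1 / N\<close> in the integration by parts formula be
  bounded by \<open>1 / (m * k)\<close>.
\<close>
locale haar_block = haar_orthogonal +
  fixes m k :: nat
  assumes m: "1 \<le> m" "m \<le> N" and k: "1 \<le> k" "k \<le> N" and mk: "m * k \<le> N"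
begin

abbreviation "block \<equiv> {..<m} \<times> {..<k}"

abbreviation "y e \<equiv> scaled_entry N (fst e) (snd e)"

abbreviation "p \<equiv> real (m * k)"

lemma p_ge_1: "1 \<le> p" and p_le_N: "p \<le> real N"
proof -
  have "1 * 1 \<le> m * k" using m k by (intro mult_le_mono)
  thus "1 \<le> p" by linarith
  show "p \<le> real N" using mk by linarith
qed

lemma card_block: "card block = m * k" and block_ne: "block \<noteq> {}" and finite_block: "finite block"
  using m k by (auto simp: card_cartesian_product lessThan_empty_iff)

lemma block_index: "e \<in> block \<Longrightarrow> fst e < N" "e \<in> block \<Longrightarrow> snd e < N"
  using m k by auto

lemma block_average_observable:
  "bounded_observable N (block_average N m k (poly P))"
  unfolding block_average_def[abs_def] using block_index
  by (intro bounded_observable_divide bounded_observable_sum bounded_observable_poly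
      bounded_observable_scaled_entry)

lemma smooth_block_average:
  "smooth_observable N (block_average N m k (poly P))
     (\<lambda>b l A. if (b, l) \<in> block then poly (pderiv P) (scaled_entry N b l A) / p else 0)"
proof -
  have 1: "smooth_observable N (\<lambda>A. (1 / p) * (\<Sum>e\<in>block. poly P (y e A)))
     (\<lambda>b l A. (1 / p) * (\<Sum>e\<in>block. poly (pderiv P) (y e A) * (if b = fst e \<and> l = snd e then 1 else 0)))"
    using block_index
    by (intro smooth_observable_scale smooth_observable_sum smooth_observable_poly smooth_observable_scaled_entry)
  show ?thesis
  proof (rule smooth_observable_cong[OF 1])
    fix A show "1 / p * (\<Sum>e\<in>block. poly P (y e A)) = block_average N m k (poly P) A"
      by (simp add: block_average_def)
  next
    fix b l A
    have "(\<Sum>e\<in>block. poly (pderiv P) (y e A) * (if b = fst e \<and> l = snd e then 1 else 0))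
      = (\<Sum>e\<in>block. if e = (b, l) then poly (pderiv P) (scaled_entry N b l A) else 0)"
      by (intro sum.cong) (auto simp: prod_eq_iff)
    also have "\<dots> = (if (b, l) \<in> block then poly (pderiv P) (scaled_entry N b l A) else 0)"
      using finite_block by (subst sum.delta) auto
    finally show "1 / p * (\<Sum>e\<in>block. poly (pderiv P) (y e A) * (if b = fst e \<and> l = snd e then 1 else 0))
      = (if (b, l) \<in> block then poly (pderiv P) (scaled_entry N b l A) / p else 0)" by simp
  qed
qed

text \<open>
  By convexity, the power of an average is at most the average of the powers, which are
  moments of single entries.
\<close>
lemma block_average_power_moment:
  assumes "\<And>x. 0 \<le> poly P x"
  shows "expectation (\<lambda>A. block_average N m k (poly P) A ^ q) \<le> poly_moment_bound (P ^ q)"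
proof -
  have obs: "bounded_observable N (\<lambda>A. poly (P ^ q) (y e A))" if "e \<in> block" for e
    using block_index[OF that] by (intro bounded_observable_poly bounded_observable_scaled_entry)
  have "expectation (\<lambda>A. block_average N m k (poly P) A ^ q)
      \<le> expectation (\<lambda>A. (\<Sum>e\<in>block. poly (P ^ q) (y e A)) / p)"
  proof (intro integral_mono observable_integrable)
    show "bounded_observable N (\<lambda>A. block_average N m k (poly P) A ^ q)"
      by (intro bounded_observable_power block_average_observable)
    show "bounded_observable N (\<lambda>A. (\<Sum>e\<in>block. poly (P ^ q) (y e A)) / p)"
      using obs by (intro bounded_observable_divide bounded_observable_sum)
    fix A
    show "block_average N m k (poly P) A ^ q \<le> (\<Sum>e\<in>block. poly (P ^ q) (y e A)) / p"
      using average_power_le[OF finite_block block_ne, of "\<lambda>e. poly P (y e A)" q] assms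
      by (simp add: block_average_def card_block poly_power)
  qed
  also have "\<dots> = (\<Sum>e\<in>block. expectation (\<lambda>A. poly (P ^ q) (y e A))) / p"
    using obs by (subst integral_divide_zero) (subst Bochner_Integration.integral_sum, auto intro: observable_integrable)
  also have "\<dots> \<le> (\<Sum>e\<in>block. poly_moment_bound (P ^ q)) / p"
    using block_index by (intro divide_right_mono sum_mono expectation_poly_le) auto
  also have "\<dots> = poly_moment_bound (P ^ q)"
    using m k by (simp add: card_block)
  finally show ?thesis .
qed

text \<open>
  The centred average \<open>G\<close> of Stein's expression \<open>y * u y - u' y\<close> behaves as if the entries were
  independent: its moment of order \<open>2 * (t + 1)\<close> is at most a constant times \<open>p\<close> to the power
  \<open>- (t + 1)\<close>. The polynomials \<open>Q\<close> and \<open>P\<close> bound the two error terms of the integration by parts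
  formula and enter only through the constant.
\<close>
lemma block_average_moment:
  fixes u :: "real poly" and t :: nat
  defines "g \<equiv> pCons 0 u - pderiv u"
    and "Q \<equiv> 1 + (pCons 0 u - pCons 0 (pCons 0 (pderiv u)))\<^sup>2"
    and "P \<equiv> u\<^sup>2 + (pderiv (pCons 0 u - pderiv u))\<^sup>2 + ([:0, 1:] ^ 4 + [:0, 1:] ^ 4) + u ^ 4 + (pderiv (pCons 0 u - pderiv u)) ^ 4"
  shows "expectation (\<lambda>A. block_average N m k (poly g) A ^ (2 * t + 2))
    \<le> 2 * (4 ^ (2 * t + 1) * poly_moment_bound (Q ^ (2 * t + 2))
          + 4 ^ t * real (2 * t + 1) ^ (t + 1) * poly_moment_bound (P ^ (t + 1))) / p ^ (t + 1)"
proof -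
  define G where "G = block_average N m k (poly g)"
  define n where "n = 2 * t + 1"
  define R where "R e A = (y e A * poly u (y e A) - (y e A)\<^sup>2 * poly (pderiv u) (y e A)) / real N" for e A
  define W where "W e A = real n / p * (poly u (y e A) * poly (pderiv g) (y e A)
      - (\<Sum>f\<in>block. scaled_entry N (fst e) (snd f) A * scaled_entry N (fst f) (snd e) A
           * poly u (y e A) * poly (pderiv g) (y f A)) / real N)" for e A
  have y_obs: "bounded_observable N (y e)" if "e \<in> block" for e
    using block_index[OF that] by auto
  have G_obs: "bounded_observable N G"
    unfolding G_def by (rule block_average_observable)
  have R_obs: "bounded_observable N (R e)" if "e \<in> block" for e
    unfolding R_def[abs_def] using y_obs[OF that]
    by (intro bounded_observable_divide bounded_observable_diff bounded_observable_mult
        bounded_observable_power bounded_observable_poly)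
  have W_obs: "bounded_observable N (W e)" if "e \<in> block" for e
    unfolding W_def[abs_def] using y_obs that block_index
    by (intro bounded_observable_divide bounded_observable_diff bounded_observable_mult
        bounded_observable_sum bounded_observable_poly bounded_observable_const
        bounded_observable_scaled_entry) auto

  \<comment> \<open>The integration by parts formula for \<open>u (y e) * G ^ n\<close>, divided by \<open>N\<close>. The term \<open>R e\<close> collects
    the corrections of order \<open>1 / N\<close> that multiply \<open>G ^ n\<close>, and \<open>W e\<close> all that comes
    from differentiating \<open>G ^ n\<close>.\<close>
  have zero: "expectation (\<lambda>A. poly g (y e A) * G A ^ n - R e A * G A ^ n - W e A * G A ^ (n - 1)) = 0"
    if e: "e \<in> block" for e
  proof -
    define d where "d b l A = poly u (y e A) * (real n * G A ^ (n - 1) *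
         (if (b, l) \<in> block then poly (pderiv g) (scaled_entry N b l A) / p else 0))
       + poly (pderiv u) (y e A) * (if b = fst e \<and> l = snd e then 1 else 0) * G A ^ n" for b l A
    have d: "smooth_observable N (\<lambda>A. poly u (y e A) * G A ^ n) d"
      unfolding d_def[abs_def] G_def
      by (intro smooth_observable_mult smooth_observable_poly smooth_observable_power
          smooth_block_average smooth_observable_scaled_entry block_index[OF e])
    have pt: "(real N - 1) * (y e A * (poly u (y e A) * G A ^ n)) - (real N * d (fst e) (snd e) A -
      (\<Sum>b<N. \<Sum>l<N. scaled_entry N (fst e) l A * scaled_entry N b (snd e) A * d b l A))
      = real N * (poly g (y e A) * G A ^ n - R e A * G A ^ n - W e A * G A ^ (n - 1))" for A
    proof -
      let ?c = "\<lambda>f. scaled_entry N (fst e) (snd f) A * scaled_entry N (fst f) (snd e) A"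
      have sub: "block \<subseteq> {..<N} \<times> {..<N}" using block_index by auto
      have "(\<Sum>b<N. \<Sum>l<N. scaled_entry N (fst e) l A * scaled_entry N b (snd e) A * d b l A)
        = (\<Sum>f\<in>{..<N} \<times> {..<N}. ?c f * d (fst f) (snd f) A)"
        by (simp add: sum.cartesian_product case_prod_beta)
      also have "\<dots> = (\<Sum>f\<in>{..<N} \<times> {..<N}. (if f \<in> block then
            ?c f * (poly u (y e A) * (real n * G A ^ (n - 1) * (poly (pderiv g) (y f A) / p))) else 0)
          + (if f = e then (y e A)\<^sup>2 * poly (pderiv u) (y e A) * G A ^ n else 0))"
        by (intro sum.cong) (auto simp: d_def power2_eq_square algebra_simps prod_eq_iff)
      also have "\<dots> = (\<Sum>f\<in>block. ?c f * (poly u (y e A) * (real n * G A ^ (n - 1) * (poly (pderiv g) (y f A) / p))))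
          + (y e A)\<^sup>2 * poly (pderiv u) (y e A) * G A ^ n"
      proof -
        have "e \<in> {..<N} \<times> {..<N}" using e sub by auto
        thus ?thesis using sub
          by (simp add: sum.distrib Int_absorb1 flip: sum.inter_restrict)
      qed
      also have "(\<Sum>f\<in>block. ?c f * (poly u (y e A) * (real n * G A ^ (n - 1) * (poly (pderiv g) (y f A) / p))))
         = (real n / p) * G A ^ (n - 1) * (\<Sum>f\<in>block. ?c f * poly u (y e A) * poly (pderiv g) (y f A))"
        unfolding sum_distrib_left by (intro sum.cong) (auto simp: field_simps)
      finally have S: "(\<Sum>b<N. \<Sum>l<N. scaled_entry N (fst e) l A * scaled_entry N b (snd e) A * d b l A)
         = (real n / p) * G A ^ (n - 1) * (\<Sum>f\<in>block. ?c f * poly u (y e A) * poly (pderiv g) (y f A))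
          + (y e A)\<^sup>2 * poly (pderiv u) (y e A) * G A ^ n" .
      have de: "d (fst e) (snd e) A = (real n / p) * poly u (y e A) * G A ^ (n - 1) * poly (pderiv g) (y e A)
          + poly (pderiv u) (y e A) * G A ^ n"
        using e by (simp add: d_def)
      have pg: "poly g (y e A) = y e A * poly u (y e A) - poly (pderiv u) (y e A)"
        by (simp add: g_def)
      have N0: "real N \<noteq> 0" using N_pos by simp
      show ?thesis
        unfolding S de R_def W_def pg using N0
        by (simp add: diff_divide_distrib right_diff_distrib left_diff_distrib) (simp add: algebra_simps)
    qed
    have "expectation (\<lambda>A. real N * (poly g (y e A) * G A ^ n - R e A * G A ^ n - W e A * G A ^ (n - 1))) = 0"
      using stein_identity_zero[OF d block_index[OF e]] unfolding pt .
    thus ?thesis using N_pos by simp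
  qed

  define R' where "R' A = (\<Sum>e\<in>block. R e A) / p" for A
  define W' where "W' A = (\<Sum>e\<in>block. W e A) / p" for A
  have R'_obs: "bounded_observable N R'"
    unfolding R'_def[abs_def] by (intro bounded_observable_divide bounded_observable_sum R_obs)
  have W'_obs: "bounded_observable N W'"
    unfolding W'_def[abs_def] by (intro bounded_observable_divide bounded_observable_sum W_obs)
  have "expectation (\<lambda>A. G A ^ (n + 1) - R' A * G A ^ n - W' A * G A ^ (n - 1)) = 0"
  proof -
    have "G A ^ (n + 1) - R' A * G A ^ n - W' A * G A ^ (n - 1)
       = (\<Sum>e\<in>block. poly g (y e A) * G A ^ n - R e A * G A ^ n - W e A * G A ^ (n - 1)) / p" for A
    proof -
      have "G A ^ (n + 1) = (\<Sum>e\<in>block. poly g (y e A)) / p * G A ^ n"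
        by (simp add: G_def block_average_def)
      thus ?thesis
        by (simp add: R'_def W'_def sum_subtractf diff_divide_distrib flip: sum_distrib_right)
    qed
    moreover have "expectation (\<lambda>A. (\<Sum>e\<in>block. poly g (y e A) * G A ^ n - R e A * G A ^ n - W e A * G A ^ (n - 1)) / p) = 0"
    proof (subst integral_divide_zero, subst Bochner_Integration.integral_sum)
      fix e assume e: "e \<in> block"
      show "integrable \<mu> (\<lambda>A. poly g (y e A) * G A ^ n - R e A * G A ^ n - W e A * G A ^ (n - 1))"
        by (intro observable_integrable bounded_observable_diff bounded_observable_mult
            bounded_observable_poly bounded_observable_power y_obs[OF e] G_obs R_obs[OF e] W_obs[OF e])
    qed (simp only: sum.neutral[OF ballI[OF zero]] div_0)
    ultimately show ?thesis by simp
  qed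
  hence main: "expectation (\<lambda>A. G A ^ (n + 1)) = expectation (\<lambda>A. R' A * G A ^ n + W' A * G A ^ (n - 1))"
  proof -
    have i: "integrable \<mu> (\<lambda>A. G A ^ (n + 1))" "integrable \<mu> (\<lambda>A. R' A * G A ^ n + W' A * G A ^ (n - 1))"
      by (intro observable_integrable bounded_observable_add bounded_observable_mult
            bounded_observable_power G_obs R'_obs W'_obs)+
    assume "expectation (\<lambda>A. G A ^ (n + 1) - R' A * G A ^ n - W' A * G A ^ (n - 1)) = 0"
    hence "expectation (\<lambda>A. G A ^ (n + 1) - (R' A * G A ^ n + W' A * G A ^ (n - 1))) = 0"
      by (simp add: algebra_simps)
    thus ?thesis using Bochner_Integration.integral_diff[OF i] by simp
  qed

  \<comment> \<open>Averaging over \<open>e\<close> gives the error terms \<open>R'\<close> and \<open>W'\<close>; both are at most \<open>1 / p\<close> times the average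
    of a fixed nonnegative polynomial.\<close>
  have R'_le: "\<bar>R' A\<bar> \<le> block_average N m k (poly Q) A / p" for A
  proof -
    have "\<bar>R e A\<bar> \<le> poly Q (y e A) / p" for e
    proof -
      define z where "z = y e A * poly u (y e A) - (y e A)\<^sup>2 * poly (pderiv u) (y e A)"
      have "0 \<le> (\<bar>z\<bar> - 1)\<^sup>2 + \<bar>z\<bar>" by simp
      also have "\<dots> = 1 + z\<^sup>2 - \<bar>z\<bar>" by (simp add: power2_diff)
      also have "1 + z\<^sup>2 = poly Q (y e A)"
        by (simp add: Q_def z_def power2_eq_square) (simp add: algebra_simps)
      finally have "\<bar>z\<bar> \<le> poly Q (y e A)" by simp
      moreover have "0 < p" using p_ge_1 by linarith
      ultimately have "\<bar>z\<bar> / real N \<le> poly Q (y e A) / p"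
        using p_le_N by (intro frac_le) auto
      thus ?thesis by (simp add: R_def z_def)
    qed
    hence "(\<Sum>e\<in>block. \<bar>R e A\<bar>) \<le> (\<Sum>e\<in>block. poly Q (y e A) / p)" by (intro sum_mono)
    hence "\<bar>\<Sum>e\<in>block. R e A\<bar> \<le> (\<Sum>e\<in>block. poly Q (y e A) / p)"
      using sum_abs[of "\<lambda>e. R e A" block] by linarith
    hence "\<bar>\<Sum>e\<in>block. R e A\<bar> / p \<le> (\<Sum>e\<in>block. poly Q (y e A) / p) / p"
      by (intro divide_right_mono) auto
    thus ?thesis by (simp add: R'_def block_average_def flip: sum_divide_distrib)
  qed

  have W'_le: "\<bar>W' A\<bar> \<le> real n / p * block_average N m k (poly P) A" for A
  proof -
    have p0: "0 < p" using p_ge_1 by linarith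
    let ?v = "\<lambda>e. poly u (y e A)" and ?w = "\<lambda>e. poly (pderiv g) (y e A)"
    let ?a = "\<lambda>e f. scaled_entry N (fst e) (snd f) A"
    have We: "\<bar>W e A\<bar> \<le> real n / p * ((?v e)\<^sup>2 + (?w e)\<^sup>2 + (\<Sum>f\<in>block. ?a e f ^ 4 + ?a f e ^ 4 + ?v e ^ 4 + ?w f ^ 4) / p)" for e
    proof -
      have 1: "\<bar>?v e * ?w e\<bar> \<le> (?v e)\<^sup>2 + (?w e)\<^sup>2"
      proof -
        have "2 * \<bar>?v e * ?w e\<bar> \<le> (?v e)\<^sup>2 + (?w e)\<^sup>2"
          using sum_squares_bound[of "\<bar>?v e\<bar>" "\<bar>?w e\<bar>"] by (simp add: abs_mult)
        moreover have "0 \<le> \<bar>?v e * ?w e\<bar>" by simp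
        ultimately show ?thesis by linarith
      qed
      have "\<bar>\<Sum>f\<in>block. ?a e f * ?a f e * ?v e * ?w f\<bar> \<le> (\<Sum>f\<in>block. \<bar>?a e f * ?a f e * ?v e * ?w f\<bar>)"
        by (rule sum_abs)
      also have "\<dots> \<le> (\<Sum>f\<in>block. ?a e f ^ 4 + ?a f e ^ 4 + ?v e ^ 4 + ?w f ^ 4)"
        by (intro sum_mono product4_le)
      finally have 2: "\<bar>\<Sum>f\<in>block. ?a e f * ?a f e * ?v e * ?w f\<bar> / real N
          \<le> (\<Sum>f\<in>block. ?a e f ^ 4 + ?a f e ^ 4 + ?v e ^ 4 + ?w f ^ 4) / p"
        using p0 p_le_N by (intro frac_le sum_nonneg) auto
      have "\<bar>W e A\<bar> = real n / p * \<bar>?v e * ?w e - (\<Sum>f\<in>block. ?a e f * ?a f e * ?v e * ?w f) / real N\<bar>"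
        unfolding W_def abs_mult by simp
      also have "\<dots> \<le> real n / p * (\<bar>?v e * ?w e\<bar> + \<bar>\<Sum>f\<in>block. ?a e f * ?a f e * ?v e * ?w f\<bar> / real N)"
        by (intro mult_left_mono order_trans[OF abs_triangle_ineq4]) auto
      also have "\<dots> \<le> real n / p * (((?v e)\<^sup>2 + (?w e)\<^sup>2) + (\<Sum>f\<in>block. ?a e f ^ 4 + ?a f e ^ 4 + ?v e ^ 4 + ?w f ^ 4) / p)"
        by (intro mult_left_mono add_mono 1 2) auto
      finally show ?thesis .
    qed
    \<comment> \<open>If \<open>e\<close> and \<open>f\<close> run over the block, the position in the row of \<open>e\<close> and the column of \<open>f\<close> runs
      over the block too, meeting each position \<open>m * k\<close> times. Hence the off-diagonal
      products are controlled by entries of the block.\<close>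
    have cross: "(\<Sum>e\<in>block. \<Sum>f\<in>block. ?a e f ^ 4) = p * (\<Sum>e\<in>block. y e A ^ 4)"
    proof -
      have nest: "(\<Sum>e\<in>block. F (fst e) (snd e)) = (\<Sum>i<m. \<Sum>j<k. F i j)" for F :: "nat \<Rightarrow> nat \<Rightarrow> real"
        by (simp add: sum.cartesian_product case_prod_beta)
      have "(\<Sum>f\<in>block. ?a e f ^ 4) = real m * (\<Sum>l<k. scaled_entry N (fst e) l A ^ 4)" for e
        using nest[of "\<lambda>b l. scaled_entry N (fst e) l A ^ 4"] by simp
      hence "(\<Sum>e\<in>block. \<Sum>f\<in>block. ?a e f ^ 4) = (\<Sum>e\<in>block. real m * (\<Sum>l<k. scaled_entry N (fst e) l A ^ 4))"
        by (intro sum.cong refl)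
      also have "\<dots> = (\<Sum>i<m. real k * (real m * (\<Sum>l<k. scaled_entry N i l A ^ 4)))"
        using nest[of "\<lambda>i j. real m * (\<Sum>l<k. scaled_entry N i l A ^ 4)"] by simp
      also have "\<dots> = p * (\<Sum>i<m. \<Sum>l<k. scaled_entry N i l A ^ 4)"
        by (simp add: sum_distrib_left mult_ac)
      also have "(\<Sum>i<m. \<Sum>l<k. scaled_entry N i l A ^ 4) = (\<Sum>e\<in>block. y e A ^ 4)"
        using nest[of "\<lambda>i l. scaled_entry N i l A ^ 4"] by simp
      finally show ?thesis .
    qed
    have cross': "(\<Sum>e\<in>block. \<Sum>f\<in>block. ?a f e ^ 4) = p * (\<Sum>e\<in>block. y e A ^ 4)"
      unfolding cross[symmetric] by (rule sum.swap)
    have c1: "(\<Sum>e\<in>block. \<Sum>f\<in>block. ?v e ^ 4) = p * (\<Sum>e\<in>block. ?v e ^ 4)"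
      "(\<Sum>e\<in>block. \<Sum>f\<in>block. ?w f ^ 4) = p * (\<Sum>e\<in>block. ?w e ^ 4)"
      by (simp_all add: card_block sum_distrib_left)
    have "\<bar>\<Sum>e\<in>block. W e A\<bar> \<le> (\<Sum>e\<in>block. \<bar>W e A\<bar>)" by (rule sum_abs)
    also have "\<dots> \<le> (\<Sum>e\<in>block. real n / p * ((?v e)\<^sup>2 + (?w e)\<^sup>2 + (\<Sum>f\<in>block. ?a e f ^ 4 + ?a f e ^ 4 + ?v e ^ 4 + ?w f ^ 4) / p))"
      by (intro sum_mono We)
    also have "\<dots> = real n / p * ((\<Sum>e\<in>block. (?v e)\<^sup>2 + (?w e)\<^sup>2)
        + (\<Sum>e\<in>block. \<Sum>f\<in>block. ?a e f ^ 4 + ?a f e ^ 4 + ?v e ^ 4 + ?w f ^ 4) / p)"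
      by (simp only: sum_distrib_left[symmetric] sum_divide_distrib[symmetric] sum.distrib)
    also have "(\<Sum>e\<in>block. \<Sum>f\<in>block. ?a e f ^ 4 + ?a f e ^ 4 + ?v e ^ 4 + ?w f ^ 4) / p
        = (\<Sum>e\<in>block. y e A ^ 4 + y e A ^ 4 + ?v e ^ 4 + ?w e ^ 4)"
      unfolding sum.distrib cross cross' c1 using p0 by (simp add: add_divide_distrib)
    also have "(\<Sum>e\<in>block. (?v e)\<^sup>2 + (?w e)\<^sup>2) + (\<Sum>e\<in>block. y e A ^ 4 + y e A ^ 4 + ?v e ^ 4 + ?w e ^ 4)
        = (\<Sum>e\<in>block. poly P (y e A))"
      unfolding sum.distrib[symmetric] by (intro sum.cong) (simp_all add: P_def g_def poly_power)
    finally have "\<bar>\<Sum>e\<in>block. W e A\<bar> / p \<le> real n / p * (\<Sum>e\<in>block. poly P (y e A)) / p"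
      by (intro divide_right_mono) auto
    thus ?thesis by (simp add: W'_def block_average_def)
  qed

  have Q_nn: "0 \<le> poly Q x" and P_nn: "0 \<le> poly P x" for x
    by (simp_all add: Q_def P_def poly_power)
  \<comment> \<open>The parameter \<open>4\<close> in both applications of Young's inequality leaves \<open>1 / 4 + 1 / 4\<close> of the moment of
    \<open>G\<close> on the right, so that half of it remains on the left.\<close>
  have young: "R' A * G A ^ n + W' A * G A ^ (n - 1)
     \<le> 4 ^ n * (block_average N m k (poly Q) A / p) ^ (2 * t + 2)
       + 4 ^ t * (real n / p * block_average N m k (poly P) A) ^ (t + 1) + G A ^ (n + 1) / 2" for A
  proof -
    have "R' A * G A ^ n \<le> \<bar>R' A\<bar> * \<bar>G A\<bar> ^ n" by (simp flip: power_abs abs_mult)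
    also have "\<dots> \<le> 4 ^ n * \<bar>R' A\<bar> ^ Suc n + \<bar>G A\<bar> ^ Suc n / 4"
      by (rule young_power) auto
    also have "\<bar>G A\<bar> ^ Suc n = G A ^ (n + 1)"
      by (simp add: n_def power_even_abs flip: power_Suc)
    finally have 1: "R' A * G A ^ n \<le> 4 ^ n * \<bar>R' A\<bar> ^ Suc n + G A ^ (n + 1) / 4" .
    have "W' A * G A ^ (n - 1) \<le> \<bar>W' A\<bar> * ((G A)\<^sup>2) ^ t"
      by (simp add: n_def power_mult mult_right_mono)
    also have "\<dots> \<le> 4 ^ t * \<bar>W' A\<bar> ^ Suc t + ((G A)\<^sup>2) ^ Suc t / 4"
      by (rule young_power) auto
    also have "((G A)\<^sup>2) ^ Suc t = G A ^ (n + 1)"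
      unfolding n_def power_mult[symmetric] by simp
    finally have 2: "W' A * G A ^ (n - 1) \<le> 4 ^ t * \<bar>W' A\<bar> ^ Suc t + G A ^ (n + 1) / 4" .
    have "4 ^ n * \<bar>R' A\<bar> ^ Suc n \<le> 4 ^ n * (block_average N m k (poly Q) A / p) ^ Suc n"
      by (intro mult_left_mono power_mono R'_le) auto
    moreover have "4 ^ t * \<bar>W' A\<bar> ^ Suc t \<le> 4 ^ t * (real n / p * block_average N m k (poly P) A) ^ Suc t"
      by (intro mult_left_mono power_mono W'_le) auto
    moreover have e: "Suc n = 2 * t + 2" "Suc t = t + 1" by (simp_all add: n_def)
    ultimately show ?thesis using 1 2 unfolding e by argo
  qed

  let ?EG = "expectation (\<lambda>A. G A ^ (n + 1))"
  have "?EG \<le> expectation (\<lambda>A. 4 ^ n * (block_average N m k (poly Q) A / p) ^ (2 * t + 2)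
       + 4 ^ t * (real n / p * block_average N m k (poly P) A) ^ (t + 1) + G A ^ (n + 1) / 2)"
    unfolding main
    by (intro integral_mono observable_integrable young bounded_observable_add bounded_observable_mult
        bounded_observable_power bounded_observable_divide bounded_observable_const
        block_average_observable G_obs R'_obs W'_obs)
  also have "\<dots> = 4 ^ n / p ^ (2 * t + 2) * expectation (\<lambda>A. block_average N m k (poly Q) A ^ (2 * t + 2))
      + 4 ^ t * (real n / p) ^ (t + 1) * expectation (\<lambda>A. block_average N m k (poly P) A ^ (t + 1)) + ?EG / 2"
  proof -
    have "bounded_observable N (\<lambda>A. block_average N m k (poly S) A ^ r)" "bounded_observable N (\<lambda>A. G A ^ (n + 1))" for S r
      by (intro bounded_observable_power block_average_observable G_obs)+
    note i = this[THEN observable_integrable]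
    have "(\<lambda>A. 4 ^ n * (block_average N m k (poly Q) A / p) ^ (2 * t + 2)
       + 4 ^ t * (real n / p * block_average N m k (poly P) A) ^ (t + 1) + G A ^ (n + 1) / 2)
     = (\<lambda>A. 4 ^ n / p ^ (2 * t + 2) * block_average N m k (poly Q) A ^ (2 * t + 2)
       + 4 ^ t * (real n / p) ^ (t + 1) * block_average N m k (poly P) A ^ (t + 1) + G A ^ (n + 1) / 2)"
      by (simp only: power_mult_distrib power_divide times_divide_eq_right times_divide_eq_left mult.assoc)
    thus ?thesis using i by (simp del: power_Suc)
  qed
  also have "\<dots> \<le> 4 ^ n / p ^ (2 * t + 2) * poly_moment_bound (Q ^ (2 * t + 2))
      + 4 ^ t * (real n / p) ^ (t + 1) * poly_moment_bound (P ^ (t + 1)) + ?EG / 2"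
    by (intro add_mono mult_left_mono block_average_power_moment Q_nn P_nn) auto
  also have "\<dots> \<le> 4 ^ n / p ^ (t + 1) * poly_moment_bound (Q ^ (2 * t + 2))
      + 4 ^ t * (real n / p) ^ (t + 1) * poly_moment_bound (P ^ (t + 1)) + ?EG / 2"
  proof -
    have "p ^ (t + 1) \<le> p ^ (2 * t + 2)" using p_ge_1 by (intro power_increasing) auto
    moreover have "0 < p ^ (t + 1)" using p_ge_1 by (intro zero_less_power) linarith
    ultimately have "4 ^ n / p ^ (2 * t + 2) \<le> 4 ^ n / p ^ (t + 1)" by (intro divide_left_mono mult_pos_pos) auto
    moreover have "0 \<le> poly_moment_bound S" for S
      unfolding poly_moment_bound_def by (intro sum_nonneg mult_nonneg_nonneg add_nonneg_nonneg prod_nonneg) auto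
    ultimately show ?thesis by (intro add_right_mono mult_right_mono)
  qed
  finally have "?EG \<le> 2 * (4 ^ n / p ^ (t + 1) * poly_moment_bound (Q ^ (2 * t + 2))
      + 4 ^ t * (real n / p) ^ (t + 1) * poly_moment_bound (P ^ (t + 1)))" by argo
  also have "\<dots> = 2 * (4 ^ n * poly_moment_bound (Q ^ (2 * t + 2))
          + 4 ^ t * real n ^ (t + 1) * poly_moment_bound (P ^ (t + 1))) / p ^ (t + 1)"
    by (simp add: power_divide add_divide_distrib)
  also have "n + 1 = 2 * t + 2" by (simp add: n_def)
  finally show ?thesis unfolding n_def G_def .
qed

end

section \<open>The empirical measure\<close>

text \<open>
  As the law of an entry at a uniformly chosen position, the empirical measure comes with its
  integrals and with the proof that it is a probability measure.
\<close>
lemma empirical_measure_eq_distr: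
  assumes "dim_row Y = m" "dim_col Y = k" "1 \<le> m" "1 \<le> k"
  shows "empirical_measure Y = distr (measure_pmf (pmf_of_set ({..<m} \<times> {..<k}))) borel (\<lambda>e. Y $$ e)"
    (is "_ = ?D")
proof -
  let ?I = "{..<m} \<times> {..<k}"
  have I: "finite ?I" "?I \<noteq> {}" "card ?I = m * k" using assms by (auto simp: lessThan_empty_iff)
  have "empirical_measure Y = measure_of UNIV (sets borel) (emeasure ?D)"
    unfolding empirical_measure_def
  proof (rule measure_of_eq)
    fix B :: "real set" assume "B \<in> sigma_sets UNIV (sets borel)"
    hence B: "B \<in> sets borel" using sets.sigma_sets_eq[of "borel :: real measure"] by simp
    have "emeasure ?D B = (\<Sum>e\<in>?I. indicator B (Y $$ e)) / real (card ?I)"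
    proof -
      have "emeasure ?D B = emeasure (measure_pmf (pmf_of_set ?I)) ((\<lambda>e. Y $$ e) -` B)"
        using B by (subst emeasure_distr) auto
      also have "\<dots> = real (card (?I \<inter> (\<lambda>e. Y $$ e) -` B)) / real (card ?I)"
        using I by (subst emeasure_pmf_of_set) auto
      also have "real (card (?I \<inter> (\<lambda>e. Y $$ e) -` B)) = (\<Sum>e\<in>?I. indicator B (Y $$ e))"
        using I(1) by (simp add: indicator_def sum.If_cases Int_def vimage_def)
      finally show ?thesis .
    qed
    also have "\<dots> = ennreal (1 / real (m * k)) * (\<Sum>e\<in>?I. ennreal (indicator B (Y $$ e)))"
      using I by (subst sum_ennreal) (simp_all add: sum_nonneg flip: ennreal_mult)
    also have "(\<Sum>e\<in>?I. ennreal (indicator B (Y $$ e))) = (\<Sum>i<m. \<Sum>j<k. emeasure (return borel (Y $$ (i, j))) B)"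
      using B by (simp add: sum.cartesian_product case_prod_beta ennreal_indicator)
    finally show "ennreal (1 / real (dim_row Y * dim_col Y)) *
        (\<Sum>i<dim_row Y. \<Sum>j<dim_col Y. emeasure (return borel (Y $$ (i, j))) B) = emeasure ?D B"
      using assms by simp
  qed simp
  also have "\<dots> = ?D" using measure_of_of_measure[of ?D] by simp
  finally show ?thesis .
qed

lemma empirical_measure_integral:
  fixes f :: "real \<Rightarrow> real"
  assumes "dim_row Y = m" "dim_col Y = k" "1 \<le> m" "1 \<le> k" and f: "f \<in> borel_measurable borel"
  shows "(\<integral>x. f x \<partial>empirical_measure Y) = (\<Sum>e\<in>{..<m} \<times> {..<k}. f (Y $$ e)) / real (m * k)"
    and "integrable (empirical_measure Y) f"
proof -
  have I: "finite ({..<m} \<times> {..<k})" "{..<m} \<times> {..<k} \<noteq> {}" using assms by (auto simp: lessThan_empty_iff)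
  show "(\<integral>x. f x \<partial>empirical_measure Y) = (\<Sum>e\<in>{..<m} \<times> {..<k}. f (Y $$ e)) / real (m * k)"
    unfolding empirical_measure_eq_distr[OF assms(1-4)] using f I
    by (subst integral_distr) (auto simp: integral_pmf_of_set)
  have "finite (set_pmf (pmf_of_set ({..<m} \<times> {..<k})))"
    by (subst set_pmf_of_set[OF I(2,1)]) (rule I(1))
  thus "integrable (empirical_measure Y) f"
    unfolding empirical_measure_eq_distr[OF assms(1-4)] using f
    by (subst integrable_distr_eq) (auto intro: integrable_measure_pmf_finite)
qed

lemma empirical_measure_real_distribution:
  assumes "dim_row Y = m" "dim_col Y = k" "1 \<le> m" "1 \<le> k"
  shows "real_distribution (empirical_measure Y)"
  unfolding empirical_measure_eq_distr[OF assms]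
  by (rule prob_space.real_distribution_distr) (auto intro: measure_pmf.prob_space_axioms)

section \<open>The method of moments for the Gaussian\<close>

lemma std_normal_moment_recurrence:
  "(LINT x|std_normal_distribution. x ^ Suc s) = real s * (LINT x|std_normal_distribution. x ^ (s - 1))"
proof (cases "even s")
  case True
  have "odd (s - 1) \<or> s = 0" using True by (cases s) auto
  thus ?thesis using True by (auto simp: integral_std_normal_distribution_moment_odd simp del: power_Suc)
next
  case False
  then obtain j where j: "s = 2 * j + 1" by (auto elim: oddE)
  have "(LINT x|std_normal_distribution. x ^ Suc s) = (LINT x|std_normal_distribution. x ^ (2 * Suc j))"
    using j by simp
  also have "\<dots> = fact (2 * Suc j) / (2 ^ Suc j * fact (Suc j))"
    by (rule std_normal_distribution_even_moments)
  also have "\<dots> = real s * (fact (2 * j) / (2 ^ j * fact j))"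
    by (simp add: j divide_simps)
  also have "fact (2 * j) / (2 ^ j * fact j) = (LINT x|std_normal_distribution. x ^ (s - 1))"
    using std_normal_distribution_even_moments(1)[of j] by (simp add: j)
  finally show ?thesis .
qed

text \<open>
  By induction on the degree, the asymptotic recurrence forces all moments to converge to those of the
  Gaussian. The Taylor polynomial of order \<open>2 * j\<close> of a characteristic function is determined by
  moments, and its error is at most a multiple of the moment of order \<open>2 * j\<close>. For the
  Gaussian this error is \<open>2 * (t\<^sup>2 / 2) ^ j / fact j\<close>, which tends to \<open>0\<close> as \<open>j\<close> grows.
\<close>
lemma moments_imp_weak_conv_std_normal:
  fixes \<mu> :: "nat \<Rightarrow> real measure"
  assumes \<mu>: "\<And>n. real_distribution (\<mu> n)"
    and int: "\<And>n r. integrable (\<mu> n) (\<lambda>x. x ^ r)"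
    and lim: "\<And>s. (\<lambda>n. (LINT x|\<mu> n. x ^ Suc s) - real s * (LINT x|\<mu> n. x ^ (s - 1))) \<longlonglongrightarrow> 0"
  shows "weak_conv_m \<mu> std_normal_distribution"
proof (rule levy_continuity[OF \<mu> real_dist_normal_dist])
  let ?\<gamma> = std_normal_distribution
  interpret \<gamma>: real_distribution ?\<gamma> by (rule real_dist_normal_dist)
  have mom: "(\<lambda>n. LINT x|\<mu> n. x ^ r) \<longlonglongrightarrow> (LINT x|?\<gamma>. x ^ r)" for r
  proof (induction r rule: less_induct)
    case (less r)
    show ?case
    proof (cases r)
      case 0
      have "(LINT x|\<mu> n. x ^ 0) = 1" for n
        using \<mu>[of n] by (simp add: real_distribution_def prob_space.prob_space)
      thus ?thesis using 0 \<gamma>.prob_space by simp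
    next
      case (Suc s)
      have "(\<lambda>n. real s * (LINT x|\<mu> n. x ^ (s - 1))) \<longlonglongrightarrow> real s * (LINT x|?\<gamma>. x ^ (s - 1))"
        using less[of "s - 1"] Suc by (cases "s = 0") (auto intro!: tendsto_intros)
      from tendsto_add[OF lim[of s] this]
      show ?thesis by (simp add: Suc std_normal_moment_recurrence del: power_Suc)
    qed
  qed
  fix t :: real
  \<comment> \<open>Taylor polynomials (\<open>S\<close>, \<open>S'\<close>) and error bounds (\<open>B\<close>, \<open>B'\<close>) at order \<open>2 * j\<close>, for the limit
    and for the sequence; the even order removes the absolute value from the moment.\<close>
  define S where "S j = (\<Sum>r\<le>2 * j. (\<i> * t) ^ r / fact r * complex_of_real (LINT x|?\<gamma>. x ^ r))" for j
  define S' where "S' n j = (\<Sum>r\<le>2 * j. (\<i> * t) ^ r / fact r * complex_of_real (LINT x|\<mu> n. x ^ r))" for n j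
  define B where "B j = 2 * \<bar>t\<bar> ^ (2 * j) / fact (2 * j) * (LINT x|?\<gamma>. x ^ (2 * j))" for j
  define B' where "B' n j = 2 * \<bar>t\<bar> ^ (2 * j) / fact (2 * j) * (LINT x|\<mu> n. x ^ (2 * j))" for n j
  have \<gamma>B: "cmod (char ?\<gamma> t - S j) \<le> B j" for j
    using \<gamma>.char_approx1[OF integrable_std_normal_distribution_moment, where n = "2 * j" and t = t]
    by (simp add: S_def B_def power_even_abs)
  have \<mu>B: "cmod (char (\<mu> n) t - S' n j) \<le> B' n j" for n j
    using real_distribution.char_approx1[OF \<mu> int, where n = "2 * j" and t = t]
    by (simp add: S'_def B'_def power_even_abs)
  have "B j = 2 * ((t\<^sup>2 / 2) ^ j / fact j)" for j
    unfolding B_def std_normal_distribution_even_moments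
    by (simp add: power_mult power_divide)
  moreover have "(\<lambda>j. (t\<^sup>2 / 2) ^ j / fact j) \<longlonglongrightarrow> 0"
  proof -
    have "(t\<^sup>2 / 2) ^ j / fact j = inverse (fact j) * (t\<^sup>2 / 2) ^ j" for j
      by (rule divide_inverse_commute)
    thus ?thesis using summable_LIMSEQ_zero[OF summable_exp[of "t\<^sup>2 / 2"]] by presburger
  qed
  ultimately have B0: "B \<longlonglongrightarrow> 0"
    using tendsto_mult_right_zero[of "\<lambda>j. (t\<^sup>2 / 2) ^ j / fact j" _ 2] by presburger
  show "(\<lambda>n. char (\<mu> n) t) \<longlonglongrightarrow> char ?\<gamma> t"
  proof (rule LIMSEQ_I)
    fix r :: real assume r: "0 < r"
    have "eventually (\<lambda>j. B j < r / 2) sequentially"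
      using order_tendstoD(2)[OF B0, of "r / 2"] r by simp
    then obtain j where j: "B j < r / 2" by (auto simp: eventually_sequentially)
    have "(\<lambda>n. B' n j + cmod (S' n j - S j) + B j) \<longlonglongrightarrow> B j + cmod (S j - S j) + B j"
    proof (intro tendsto_intros)
      show "(\<lambda>n. B' n j) \<longlonglongrightarrow> B j" unfolding B'_def B_def by (intro tendsto_intros mom)
      show "(\<lambda>n. S' n j) \<longlonglongrightarrow> S j" unfolding S'_def S_def by (intro tendsto_intros mom)
    qed
    hence "eventually (\<lambda>n. B' n j + cmod (S' n j - S j) + B j < r) sequentially"
      by (rule order_tendstoD) (use j in simp)
    then obtain n0 where n0: "\<And>n. n \<ge> n0 \<Longrightarrow> B' n j + cmod (S' n j - S j) + B j < r"
      by (auto simp: eventually_sequentially)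
    show "\<exists>no. \<forall>n\<ge>no. norm (char (\<mu> n) t - char ?\<gamma> t) < r"
    proof (intro exI allI impI)
      fix n assume n: "n \<ge> n0"
      have "char (\<mu> n) t - char ?\<gamma> t = (char (\<mu> n) t - S' n j) + (S' n j - S j) - (char ?\<gamma> t - S j)"
        by simp
      also have "cmod \<dots> \<le> cmod (char (\<mu> n) t - S' n j) + cmod (S' n j - S j) + cmod (char ?\<gamma> t - S j)"
        by (intro order_trans[OF norm_triangle_ineq4] add_right_mono norm_triangle_ineq)
      also have "\<dots> \<le> B' n j + cmod (S' n j - S j) + B j"
        by (intro add_mono \<mu>B \<gamma>B order_refl)
      finally show "norm (char (\<mu> n) t - char ?\<gamma> t) < r" using n0[OF n] by simp
    qed
  qed
qed

section \<open>Convergence in the weak topology\<close>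

text \<open>
  It suffices to test the sets that generate the topology, and for these the claim is convergence of
  the integral of one bounded continuous function.
\<close>
lemma weak_conv_imp_limitin_weak_topology:
  fixes \<mu> :: "nat \<Rightarrow> real measure"
  assumes \<mu>: "\<And>n. real_distribution (\<mu> n)" and \<gamma>: "real_distribution \<gamma>" and conv: "weak_conv_m \<mu> \<gamma>"
  shows "limitin weak_topology \<mu> \<gamma> sequentially"
proof -
  have bp: "\<eta> \<in> borel_probabilities" if "real_distribution \<eta>" for \<eta>
    using that by (auto simp: borel_probabilities_def real_distribution_def real_distribution_axioms_def)
  have "eventually (\<lambda>n. \<mu> n \<in> U) sequentially"
    if U: "openin weak_topology U" "\<gamma> \<in> U" for U
  proof -
    from U(1) have "generate_topology_on
      {{\<mu> \<in> borel_probabilities. (\<integral>x. f x \<partial>\<mu>) \<in> V} | (f :: real \<Rightarrow> real) (V :: real set).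
        continuous_on UNIV f \<and> bounded (range f) \<and> open V} U"
      by (simp add: weak_topology_def openin_topology_generated_by_iff)
    thus ?thesis using U(2)
    proof induction
      case (Basis s)
      then obtain f :: "real \<Rightarrow> real" and V where s: "s = {\<mu> \<in> borel_probabilities. (\<integral>x. f x \<partial>\<mu>) \<in> V}"
        and f: "continuous_on UNIV f" "bounded (range f)" and V: "open V" by blast
      from f(2) obtain b where b: "\<And>x. norm (f x) \<le> b" by (auto simp: bounded_iff)
      have "(\<lambda>n. \<integral>x. f x \<partial>\<mu> n) \<longlonglongrightarrow> (\<integral>x. f x \<partial>\<gamma>)"
        by (rule weak_conv_imp_integral_bdd_continuous_conv[OF \<mu> \<gamma> conv _ b])
           (use f(1) in \<open>auto simp: continuous_on_eq_continuous_at\<close>)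
      from topological_tendstoD[OF this V] Basis(2) bp[OF \<mu>] show ?case
        unfolding s by (auto elim: eventually_mono)
    next
      case (UN K)
      then obtain k where k: "k \<in> K" "\<gamma> \<in> k" by blast
      from UN.IH[OF this] show ?case by (rule eventually_mono) (use k in auto)
    qed (auto simp: eventually_conj_iff)
  qed
  moreover have "\<gamma> \<in> topspace weak_topology"
    unfolding weak_topology_def topology_generated_by_topspace
    by (rule UnionI[of "{\<mu> \<in> borel_probabilities. (\<integral>x. (\<lambda>_. 0) x \<partial>\<mu>) \<in> (UNIV :: real set)}"])
       (use bp[OF \<gamma>] in \<open>auto intro!: exI[of _ "\<lambda>_. 0"] exI[of _ UNIV]\<close>)
  ultimately show ?thesis by (simp add: limitin_def)
qed

section \<open>Almost sure convergence\<close>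

text \<open>
  The sum of the powers has finite expectation, hence is almost surely finite, and then its terms tend
  to \<open>0\<close>.
\<close>
lemma (in prob_space) AE_tendsto_0_if_summable_moments:
  fixes Z :: "nat \<Rightarrow> 'a \<Rightarrow> real"
  assumes int: "\<And>n. integrable M (\<lambda>\<omega>. Z n \<omega> ^ r)" and r: "even r" "0 < r"
    and sum: "summable (\<lambda>n. expectation (\<lambda>\<omega>. Z n \<omega> ^ r))"
  shows "AE \<omega> in M. (\<lambda>n. Z n \<omega>) \<longlonglongrightarrow> 0"
proof -
  have nn: "0 \<le> Z n \<omega> ^ r" for n \<omega> using r(1) by (rule zero_le_even_power)
  have "(\<integral>\<^sup>+\<omega>. (\<Sum>n. ennreal (Z n \<omega> ^ r)) \<partial>M) = (\<Sum>n. \<integral>\<^sup>+\<omega>. ennreal (Z n \<omega> ^ r) \<partial>M)"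
    using int by (intro nn_integral_suminf) auto
  also have "\<dots> = (\<Sum>n. ennreal (expectation (\<lambda>\<omega>. Z n \<omega> ^ r)))"
    using int nn by (simp add: nn_integral_eq_integral)
  also have "\<dots> = ennreal (\<Sum>n. expectation (\<lambda>\<omega>. Z n \<omega> ^ r))"
    using sum nn by (intro suminf_ennreal2) auto
  finally have "(\<integral>\<^sup>+\<omega>. (\<Sum>n. ennreal (Z n \<omega> ^ r)) \<partial>M) \<noteq> \<infinity>" by simp
  hence "AE \<omega> in M. (\<Sum>n. ennreal (Z n \<omega> ^ r)) \<noteq> \<infinity>"
    using int by (intro nn_integral_noteq_infinite borel_measurable_suminf) auto
  thus ?thesis
  proof eventually_elim
    case (elim \<omega>)
    hence "summable (\<lambda>n. Z n \<omega> ^ r)" using nn by (intro summable_suminf_not_top) auto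
    hence "(\<lambda>n. Z n \<omega> ^ r) \<longlonglongrightarrow> 0" by (rule summable_LIMSEQ_zero)
    from tendsto_real_root[OF this, of r]
    have "(\<lambda>n. root r (Z n \<omega> ^ r)) \<longlonglongrightarrow> 0" by simp
    moreover have "root r (Z n \<omega> ^ r) = \<bar>Z n \<omega>\<bar>" for n
      using real_root_power_cancel[OF r(2), of "\<bar>Z n \<omega>\<bar>"] r(1) by (simp add: power_even_abs)
    ultimately have "(\<lambda>n. \<bar>Z n \<omega>\<bar>) \<longlonglongrightarrow> 0" by simp
    thus ?case by (simp add: tendsto_rabs_zero_iff)
  qed
qed

theorem corollary2p2:
  fixes M :: "'w measure"
    and A :: "nat \<Rightarrow> 'w \<Rightarrow> real mat"
    and m k :: "nat \<Rightarrow> nat"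
    and \<alpha> :: real
    and \<nu> :: "nat \<Rightarrow> 'w \<Rightarrow> real measure"
  assumes "prob_space M"
    and "\<And>N. N \<ge> 1 \<Longrightarrow> A N \<in> M \<rightarrow>\<^sub>M orthogonal_borel N"
    and "\<And>N. N \<ge> 1 \<Longrightarrow> haar_probability N (distr M (orthogonal_borel N) (A N))"
    and "0 < \<alpha>" and "\<alpha> < 1"
    and "\<And>N. N \<ge> 1 \<Longrightarrow> int (m N * k N) = \<lfloor>real N powr \<alpha>\<rfloor>"
    and "\<And>N \<omega>. \<nu> N \<omega> =
           empirical_measure (sqrt (real N) \<cdot>\<^sub>m upper_left_block (m N) (k N) (A N \<omega>))"
  shows "AE \<omega> in M. limitin weak_topology (\<lambda>N. \<nu> N \<omega>) std_normal_distribution sequentially"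
proof -
  interpret prob_space M by (rule assms(1))
  define p where "p N = real (m N * k N)" for N
  have size: "1 \<le> m N" "m N \<le> N" "1 \<le> k N" "k N \<le> N" "m N * k N \<le> N" "real N powr \<alpha> / 2 \<le> p N"
    if N: "N \<ge> 1" for N
  proof -
    have p: "p N = real_of_int \<lfloor>real N powr \<alpha>\<rfloor>"
      using assms(6)[OF N] unfolding p_def by (metis of_int_of_nat_eq)
    have ge1: "1 \<le> real N powr \<alpha>" using N assms(4) by (intro ge_one_powr_ge_zero) auto
    have "real N powr \<alpha> \<le> real N powr 1" using N assms(5) by (intro powr_mono) auto
    hence le: "real N powr \<alpha> \<le> real N" using N by simp
    have p1: "1 \<le> p N" using ge1 unfolding p by (simp add: le_floor_iff)
    have "p N \<le> real N" using le unfolding p by linarith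
    thus mkN: "m N * k N \<le> N" unfolding p_def by linarith
    have "m N * k N \<noteq> 0" using p1 unfolding p_def by linarith
    thus "1 \<le> m N" "1 \<le> k N" by auto
    hence "m N * 1 \<le> m N * k N" "1 * k N \<le> m N * k N" by (intro mult_le_mono; simp)+
    thus "m N \<le> N" "k N \<le> N" using mkN by linarith+
    have "real N powr \<alpha> \<le> p N + 1" unfolding p by linarith
    thus "real N powr \<alpha> / 2 \<le> p N" using p1 by linarith
  qed

  \<comment> \<open>Stein's expression for \<open>u = x ^ s\<close>. The index starts at
    \<open>N = 1\<close>, the first dimension with a nonempty block.\<close>
  have "AE \<omega> in M. (\<lambda>n. block_average (Suc n) (m (Suc n)) (k (Suc n)) (\<lambda>x. x ^ Suc s - real s * x ^ (s - 1)) (A (Suc n) \<omega>)) \<longlonglongrightarrow> 0" for s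
  proof -
    define u :: "real poly" where "u = monom 1 s"
    define g where "g = pCons 0 u - pderiv u"
    have g: "poly g x = x ^ Suc s - real s * x ^ (s - 1)" for x
      by (simp add: g_def u_def poly_monom pderiv_monom)
    \<comment> \<open>The moment of order \<open>2 * (t + 1)\<close> is of order \<open>N\<close> to the power \<open>- \<alpha> * (t + 1)\<close>; this choice of
      \<open>t\<close> makes it \<open>O (1 / N\<^sup>2)\<close>.\<close>
    obtain t :: nat where "2 / \<alpha> \<le> real t" using real_arch_simple by blast
    hence t: "2 \<le> \<alpha> * real (t + 1)" using assms(4) by (simp add: field_simps)
    define Q where "Q = 1 + (pCons 0 u - pCons 0 (pCons 0 (pderiv u)))\<^sup>2"
    define P where "P = u\<^sup>2 + (pderiv g)\<^sup>2 + ([:0, 1:] ^ 4 + [:0, 1:] ^ 4) + u ^ 4 + (pderiv g) ^ 4"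
    define C where "C = 2 * (4 ^ (2 * t + 1) * poly_moment_bound (Q ^ (2 * t + 2))
          + 4 ^ t * real (2 * t + 1) ^ (t + 1) * poly_moment_bound (P ^ (t + 1)))"
    define Z where "Z n \<omega> = block_average (Suc n) (m (Suc n)) (k (Suc n)) (poly g) (A (Suc n) \<omega>)" for n \<omega>
    have mom: "integrable M (\<lambda>\<omega>. Z n \<omega> ^ (2 * t + 2)) \<and> 
        expectation (\<lambda>\<omega>. Z n \<omega> ^ (2 * t + 2)) \<le> C / p (Suc n) ^ (t + 1)" for n
    proof -
      let ?N = "Suc n"
      let ?\<mu> = "distr M (orthogonal_borel ?N) (A ?N)"
      have N1: "?N \<ge> 1" by simp
      have meas: "A ?N \<in> M \<rightarrow>\<^sub>M orthogonal_borel ?N" by (rule assms(2)[OF N1])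
      interpret H: haar_block ?\<mu> ?N "m ?N" "k ?N"
        unfolding haar_block_def haar_orthogonal_def haar_orthogonal_axioms_def haar_block_axioms_def
        using assms(3)[OF N1] prob_space_distr[OF meas] size[OF N1] by simp
      let ?F = "\<lambda>A. block_average ?N (m ?N) (k ?N) (poly g) A ^ (2 * t + 2)"
      have obs: "bounded_observable ?N ?F"
        by (intro bounded_observable_power H.block_average_observable)
      hence F: "?F \<in> borel_measurable (orthogonal_borel ?N)" by (simp add: bounded_observable_def)
      have "integrable M (\<lambda>\<omega>. ?F (A ?N \<omega>))"
        by (rule integrable_distr[OF meas H.observable_integrable[OF obs]])
      moreover have "expectation (\<lambda>\<omega>. ?F (A ?N \<omega>)) = H.expectation ?F"
        using meas F by (intro integral_distr[symmetric])
      moreover have "H.expectation ?F \<le> C / p ?N ^ (t + 1)"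
        using H.block_average_moment[of u t] by (simp only: C_def p_def P_def Q_def g_def add.assoc)
      ultimately show ?thesis by (simp only: Z_def)
    qed
    have "AE \<omega> in M. (\<lambda>n. Z n \<omega>) \<longlonglongrightarrow> 0"
    proof (rule AE_tendsto_0_if_summable_moments[of _ "2 * t + 2"])
      have C: "0 \<le> C"
        unfolding C_def poly_moment_bound_def
        by (intro mult_nonneg_nonneg add_nonneg_nonneg sum_nonneg prod_nonneg) auto
      show "summable (\<lambda>n. expectation (\<lambda>\<omega>. Z n \<omega> ^ (2 * t + 2)))"
      proof (rule summable_comparison_test')
        have "summable (\<lambda>n. inverse (real (Suc n) ^ 2))"
          using inverse_power_summable[of 2, where ?'a = real] by (subst summable_Suc_iff) auto
        thus "summable (\<lambda>n. C * 2 ^ (t + 1) * inverse (real (Suc n) ^ 2))" by (rule summable_mult)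
        fix n :: nat
        let ?N = "real (Suc n)"
        have "?N ^ 2 = ?N powr 2" by (simp add: powr_numeral)
        also have "\<dots> \<le> ?N powr (\<alpha> * real (t + 1))" using t by (intro powr_mono) auto
        also have "\<dots> = (?N powr \<alpha>) ^ (t + 1)"
          by (simp add: powr_powr[symmetric] powr_realpow del: of_nat_Suc of_nat_add)
        also have "\<dots> \<le> (2 * p (Suc n)) ^ (t + 1)"
          using size(6)[of "Suc n"] by (intro power_mono) auto
        also have "\<dots> = 2 ^ (t + 1) * p (Suc n) ^ (t + 1)" by (rule power_mult_distrib)
        finally have le: "?N ^ 2 \<le> 2 ^ (t + 1) * p (Suc n) ^ (t + 1)" .
        have "0 < ?N ^ 2" by simp
        hence "0 < p (Suc n) ^ (t + 1)" using le
          by (metis less_le_trans zero_less_mult_pos zero_less_numeral zero_less_power)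
        have "expectation (\<lambda>\<omega>. Z n \<omega> ^ (2 * t + 2)) \<le> C / p (Suc n) ^ (t + 1)" using mom by blast
        also have "\<dots> \<le> C * 2 ^ (t + 1) * inverse (?N ^ 2)"
        proof -
          have "C * ?N ^ 2 \<le> C * (2 ^ (t + 1) * p (Suc n) ^ (t + 1))" using le C by (rule mult_left_mono)
          thus ?thesis using \<open>0 < p (Suc n) ^ (t + 1)\<close> \<open>0 < ?N ^ 2\<close>
            by (simp add: field_simps del: of_nat_Suc power_Suc)
        qed
        moreover have "0 \<le> expectation (\<lambda>\<omega>. Z n \<omega> ^ (2 * t + 2))"
          by (intro integral_nonneg_AE AE_I2 zero_le_even_power) simp
        ultimately show "norm (expectation (\<lambda>\<omega>. Z n \<omega> ^ (2 * t + 2))) \<le> C * 2 ^ (t + 1) * inverse (?N ^ 2)"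
          by simp
      qed
    qed (use mom in auto)
    moreover have "poly g = (\<lambda>x. x ^ Suc s - real s * x ^ (s - 1))" using g by blast
    ultimately show ?thesis by (simp only: Z_def)
  qed
  hence "AE \<omega> in M. \<forall>s. (\<lambda>n. block_average (Suc n) (m (Suc n)) (k (Suc n)) (\<lambda>x. x ^ Suc s - real s * x ^ (s - 1)) (A (Suc n) \<omega>)) \<longlonglongrightarrow> 0"
    by (simp add: AE_all_countable)
  thus ?thesis
  proof eventually_elim
    case (elim \<omega>)
    define Y where "Y n = sqrt (real (Suc n)) \<cdot>\<^sub>m upper_left_block (m (Suc n)) (k (Suc n)) (A (Suc n) \<omega>)" for n
    have \<nu>: "\<nu> (Suc n) \<omega> = empirical_measure (Y n)" for n
      by (simp only: assms(7) Y_def)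
    have dim: "dim_row (Y n) = m (Suc n)" "dim_col (Y n) = k (Suc n)" "1 \<le> m (Suc n)" "1 \<le> k (Suc n)" for n
      using size(1,3)[of "Suc n"] by (simp_all add: Y_def upper_left_block_def)
    have rd: "real_distribution (\<nu> (Suc n) \<omega>)" for n
      unfolding \<nu> by (rule empirical_measure_real_distribution[OF dim])
    have int: "integrable (\<nu> (Suc n) \<omega>) (\<lambda>x. x ^ r)" for n r
      unfolding \<nu> by (rule empirical_measure_integral(2)[OF dim]) simp
    have diff: "(LINT x|\<nu> (Suc n) \<omega>. x ^ Suc s) - real s * (LINT x|\<nu> (Suc n) \<omega>. x ^ (s - 1))
       = block_average (Suc n) (m (Suc n)) (k (Suc n)) (\<lambda>x. x ^ Suc s - real s * x ^ (s - 1)) (A (Suc n) \<omega>)" for n s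
    proof -
      have "(LINT x|\<nu> (Suc n) \<omega>. x ^ Suc s) - real s * (LINT x|\<nu> (Suc n) \<omega>. x ^ (s - 1))
         = (LINT x|\<nu> (Suc n) \<omega>. x ^ Suc s - real s * x ^ (s - 1))"
        using int[of n "Suc s"] int[of n "s - 1"]
        by (subst Bochner_Integration.integral_diff) auto
      also have "\<dots> = (\<Sum>e\<in>{..<m (Suc n)} \<times> {..<k (Suc n)}. (Y n $$ e) ^ Suc s - real s * (Y n $$ e) ^ (s - 1))
          / real (m (Suc n) * k (Suc n))"
        unfolding \<nu> by (rule empirical_measure_integral(1)[OF dim]) simp
      also have "\<dots> = block_average (Suc n) (m (Suc n)) (k (Suc n)) (\<lambda>x. x ^ Suc s - real s * x ^ (s - 1)) (A (Suc n) \<omega>)"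
        unfolding block_average_def
        by (intro arg_cong2[where f = "(/)"] sum.cong refl)
           (auto simp: Y_def upper_left_block_def scaled_entry_def)
      finally show ?thesis .
    qed
    have "weak_conv_m (\<lambda>n. \<nu> (Suc n) \<omega>) std_normal_distribution"
      by (rule moments_imp_weak_conv_std_normal[OF rd int]) (use elim diff in simp)
    hence "limitin weak_topology (\<lambda>n. \<nu> (Suc n) \<omega>) std_normal_distribution sequentially"
      by (rule weak_conv_imp_limitin_weak_topology[OF rd real_dist_normal_dist])
    thus ?case
      using limitin_sequentially_offset_rev[of weak_topology "\<lambda>N. \<nu> N \<omega>" 1] by simp
  qed
qed

end
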